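(* Let $f \colon \mathbb{R}^n \rightarrow \mathbb{R}$ be a continuous semi-algebraic function and assume that $S := \{x \in \mathbb{R}^n : f(x) \le 0 \} \ne \emptyset$. Then the following two statements are equivalent. (i) For any sequence $x^k \in \mathbb{R}^n \setminus S$ with $x^k \to \infty$, we have (i1) if $f(x^k) \to 0$ then $d(x^k,S) \to 0$; (i2) if $d(x^k,S) \to \infty$ then $f(x^k) \to \infty$. (ii) There exist some constants $c > 0$, $\alpha > 0$, and $\beta > 0$ such that $$c\, d(x, S) \le [f(x)]_+^{\alpha} + [f(x)]_+^{\beta} \quad \text{for all } x \in \mathbb{R}^n.$$
   Context: $d(x,S)$ denotes the Euclidean distance from $x$ to $S$; $[f(x)]_+ := \max\{f(x),0\}$; $x^k\to\infty$ means $\|x^k\|\to\infty$. A subset of $\mathbb{R}^n$ is semi-algebraic if it is a finite union of sets defined by finitely many polynomial equations $g=0$ and strict inequalities $g>0$; a function is semi-algebraic if its graph is a semi-algebraic set. *)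

theory Defs
  imports "HOL-Analysis.Analysis"
begin

text \<open>
  Polynomials are taken as the functions satisfying \<^const>\<open>real_polynomial_function\<close>: the closure of
  the constants and the linear functionals under sums and products, which on a Euclidean space
  is exactly the set of polynomial functions in the coordinates.
\<close>

definition basic_semialgebraic :: "'a::euclidean_space set \<Rightarrow> bool" where
  "basic_semialgebraic A \<longleftrightarrow>
     (\<exists>P Q. finite P \<and> finite Q \<and> (\<forall>g \<in> P \<union> Q. real_polynomial_function g) \<and>
            A = {x. (\<forall>g\<in>P. g x = 0) \<and> (\<forall>g\<in>Q. g x > 0)})"

definition semialgebraic :: "'a::euclidean_space set \<Rightarrow> bool" where
  "semialgebraic A \<longleftrightarrow> (\<exists>F. finite F \<and> (\<forall>B\<in>F. basic_semialgebraic B) \<and> A = \<Union>F)"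

text \<open>
  The graph lives in the product space, whose coordinates are those of the domain together with
  one further real coordinate.
\<close>

definition semialgebraic_function :: "('a::euclidean_space \<Rightarrow> real) \<Rightarrow> bool" where
  "semialgebraic_function f \<longleftrightarrow> semialgebraic (range (\<lambda>x. (x, f x)))"

end

theory Submission
  imports Defs
begin

text \<open>
  One direction is elementary: an error bound squeezes \<open>infdist (x k) S\<close> between \<open>0\<close> and a power sum of
  the residuals, and a bounded residual keeps the distance bounded.

  For the converse, let \<open>\<phi> t\<close> be the supremum of the distances to \<open>S\<close> over the sublevel set \<open>f \<le> t\<close>.
  The second sequence condition makes \<open>\<phi>\<close> finite (\<open>infdist_bounded_on_sublevel\<close>); the first one,
  together with compactness of balls, makes it tend to \<open>0\<close> at \<open>0\<close>
  (\<open>infdist_small_on_small_sublevel\<close>). It remains to see that \<open>\<phi>\<close> grows like a power at \<open>0\<close> and at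
  infinity. This is where semialgebraicity enters: the points \<open>(t, \<phi> t)\<close> with \<open>\<phi> t > 0\<close> lie on a plane
  algebraic curve (\<open>max_infdist_on_curve\<close>). A curve \<open>P(t, r) = 0\<close>, read as a polynomial in \<open>r\<close>, bounds
  its roots polynomially in \<open>t\<close> for large \<open>t\<close>. Read as a polynomial in \<open>t\<close>, with the powers of \<open>t\<close>
  divided out, its constant term is a nonzero polynomial \<open>b(r)\<close> with \<open>\<bar>b(r)\<bar> \<le> M t\<close> near the origin,
  so that \<open>r ^ m \<le> C t\<close> there (\<open>power_bound_of_function_on_curve\<close>).

  That the curve exists is a consequence of the Tarski-Seidenberg theorem, since the set of all
  \<open>(t, r)\<close> such that some \<open>x\<close> with \<open>f x \<le> t\<close> has distance at least \<open>r\<close> from \<open>S\<close> arises from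
  semialgebraic sets by quantification over the coordinates of \<open>x\<close> and of the points of \<open>S\<close>. The
  theorem is proved in a semantic form. A set of assignments of reals to variables is called
  sign-determined if finitely many polynomial functions exist such that membership depends on
  their signs only; these are exactly the semialgebraic sets, and closure under Boolean operations
  is immediate. Closure under projection (\<open>sign_determined_ex_variable\<close>) follows the elimination
  of Cohen and Hoermander: for a finite family of polynomials in one variable whose coefficients
  are polynomial functions of parameters, finitely many functions of the parameters have signs that
  fix the order in which all roots occur along the line and all signs at and between them
  (\<open>finitely_many_signs_determine_chart\<close>). "The same pattern for two parameter values" is expressed
  by an increasing bijection of the real line that transports the signs. Such a bijection can be
  extended to one more polynomial \<open>p\<close> as soon as it respects \<open>p'\<close> and the remainders of \<open>p\<close> modulo the
  other polynomials (\<open>sign_chart_extend\<close>), which have smaller degree.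

  Finally, where the fibre over \<open>t\<close> of a sign-determined subset of the plane has a frontier point \<open>r\<close>,
  one of the finitely many polynomials that are not identically zero on the plane has to vanish at
  \<open>(t, r)\<close>, because otherwise no sign would change near \<open>r\<close> (\<open>frontier_of_fibre_on_curve\<close>).
\<close>

section \<open>Signs of a real polynomial along the line\<close>

lemma sgn_poly_eq_if_no_root:
  fixes p :: "real poly"
  assumes "a \<le> b" "\<And>x. a \<le> x \<Longrightarrow> x \<le> b \<Longrightarrow> poly p x \<noteq> 0"
  shows "sgn (poly p a) = sgn (poly p b)"
proof (rule ccontr)
  assume neq: "sgn (poly p a) \<noteq> sgn (poly p b)"
  then have "a < b" using assms(1) by (cases "a = b") auto
  moreover have "poly p a \<noteq> 0" "poly p b \<noteq> 0" using assms by auto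
  then have "poly p a * poly p b < 0"
    using neq by (auto simp: sgn_if mult_less_0_iff split: if_splits)
  ultimately show False using poly_IVT[of a b p] assms(2) by force
qed

lemma sgn_poly_beyond_roots:
  fixes p :: "real poly"
  assumes "\<And>x. M \<le> x \<Longrightarrow> poly p x \<noteq> 0"
  shows "sgn (poly p M) = sgn (lead_coeff p)"
proof -
  have pos: "sgn (poly p M) = 1" if lc: "lead_coeff p > 0" and "\<And>x. M \<le> x \<Longrightarrow> poly p x \<noteq> 0" for p :: "real poly"
  proof -
    obtain n where n: "\<forall>x\<ge>n. poly p x \<ge> lead_coeff p"
      using poly_pinfty_gt_lc[OF lc] by blast
    have "sgn (poly p M) = sgn (poly p (max M n))"
      by (rule sgn_poly_eq_if_no_root) (use that in auto)
    also have "\<dots> = 1" using n[rule_format, of "max M n"] that(1) by auto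
    finally show ?thesis .
  qed
  have "p \<noteq> 0" using assms[of M] by auto
  then consider "lead_coeff p > 0" | "lead_coeff (- p) > 0"
    using leading_coeff_neq_0[of p] by fastforce
  then show ?thesis
  proof cases
    case 1 then show ?thesis using pos[of p] assms by simp
  next
    case 2 then show ?thesis using pos[of "- p"] assms by (simp add: sgn_minus)
  qed
qed

lemma sgn_poly_before_roots:
  fixes p :: "real poly"
  assumes "\<And>x. x \<le> M \<Longrightarrow> poly p x \<noteq> 0"
  shows "sgn (poly p M) = (- 1) ^ degree p * sgn (lead_coeff p)"
proof -
  let ?r = "pcompose p [:0, - 1:]"
  have "sgn (poly ?r (- M)) = sgn (lead_coeff ?r)"
    by (rule sgn_poly_beyond_roots) (use assms in \<open>auto simp: poly_pcompose\<close>)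
  moreover have "lead_coeff ?r = lead_coeff p * (- 1) ^ degree p"
    by (subst lead_coeff_comp) auto
  ultimately show ?thesis
    by (cases "even (degree p)") (simp_all add: poly_pcompose sgn_mult)
qed

lemma poly_Rolle:
  fixes p :: "real poly"
  assumes "a < b" "poly p a = 0" "poly p b = 0"
  shows "\<exists>x. a < x \<and> x < b \<and> poly (pderiv p) x = 0"
  using poly_MVT[OF assms(1), of p] assms by auto

text \<open>
  Between two neighbouring roots of the derivative a polynomial is strictly monotone. Hence its values
  at the ends of such a gap tell whether it has a root inside, which is what allows roots to be
  carried from one polynomial to another.
\<close>

lemma poly_opposite_signs_around_root:
  fixes p :: "real poly"
  assumes "a < x" "x < b" "poly p x = 0"
    and no_root: "\<And>y. a < y \<Longrightarrow> y < b \<Longrightarrow> poly (pderiv p) y \<noteq> 0"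
  shows "poly p a * poly p b < 0"
proof -
  obtain u where u: "a < u" "u < x" "poly p x - poly p a = (x - a) * poly (pderiv p) u"
    using poly_MVT[OF assms(1), of p] by blast
  obtain v where v: "x < v" "v < b" "poly p b - poly p x = (b - x) * poly (pderiv p) v"
    using poly_MVT[OF assms(2), of p] by blast
  have "sgn (poly (pderiv p) u) = sgn (poly (pderiv p) v)"
    by (rule sgn_poly_eq_if_no_root) (use u v no_root in auto)
  moreover have "poly (pderiv p) u \<noteq> 0" using no_root u assms by auto
  ultimately have "poly (pderiv p) u * poly (pderiv p) v > 0"
    by (auto simp: sgn_if zero_less_mult_iff split: if_splits)
  then have "((x - a) * (b - x)) * (poly (pderiv p) u * poly (pderiv p) v) > 0"
    using assms by simp
  moreover have "poly p a = - ((x - a) * poly (pderiv p) u)" "poly p b = (b - x) * poly (pderiv p) v"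
    using u v assms(3) by simp_all
  ultimately show ?thesis by (simp add: mult_ac)
qed

section \<open>Transporting sign patterns by increasing bijections\<close>

text \<open>
  The bijection is affine on either side of \<open>a\<close> within the interval. It is used to correct a chart
  inside a single gap without disturbing it elsewhere.
\<close>

lemma strict_mono_surj_moving_point:
  fixes u v a b :: real
  assumes "u < a" "a < v" "u < b" "b < v"
  obtains k where "strict_mono k" "surj k" "k a = b" "\<And>y. y \<le> u \<or> v \<le> y \<Longrightarrow> k y = y"
proof -
  define k where "k a b y = (if y \<le> u \<or> v \<le> y then y
      else if y \<le> a then u + (y - u) * ((b - u) / (a - u))
      else v - (v - y) * ((v - b) / (v - a)))" for a b y
  have low: "u < k a b y \<and> k a b y \<le> b" if "u < a" "a < v" "u < b" "b < v" "u < y" "y \<le> a" for a b y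
  proof -
    have "(y - u) * ((b - u) / (a - u)) > 0" using that by simp
    moreover have "(y - u) * ((b - u) / (a - u)) \<le> (a - u) * ((b - u) / (a - u))"
      using that by (intro mult_right_mono) auto
    ultimately show ?thesis using that by (simp add: k_def)
  qed
  have high: "b < k a b y \<and> k a b y < v" if "u < a" "a < v" "u < b" "b < v" "a < y" "y < v" for a b y
  proof -
    have "(v - y) * ((v - b) / (v - a)) > 0" using that by simp
    moreover have "(v - y) * ((v - b) / (v - a)) < (v - a) * ((v - b) / (v - a))"
      using that by (intro mult_strict_right_mono) auto
    ultimately show ?thesis using that by (simp add: k_def)
  qed
  have inv: "k b a (k a b y) = y" if *: "u < a" "a < v" "u < b" "b < v" for a b y
  proof -
    consider "y \<le> u \<or> v \<le> y" | "u < y" "y \<le> a" | "a < y" "y < v" by linarith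
    then show ?thesis
    proof cases
      case 1 then show ?thesis by (auto simp: k_def)
    next
      case 2
      have "k b a (k a b y) = u + (k a b y - u) * ((a - u) / (b - u))"
        using low[OF * 2] * by (simp add: k_def)
      also have "k a b y - u = (y - u) * ((b - u) / (a - u))" using 2 * by (simp add: k_def)
      finally show ?thesis using * by simp
    next
      case 3
      have "k b a (k a b y) = v - (v - k a b y) * ((v - a) / (v - b))"
        using high[OF * 3] * by (simp add: k_def)
      also have "v - k a b y = (v - y) * ((v - b) / (v - a))" using 3 * by (simp add: k_def)
      finally show ?thesis using * by simp
    qed
  qed
  have mono: "k a b y < k a b z" if yz: "y < z" for y z
  proof -
    have l: "k a b y < k a b z" if "u < y" "z \<le> a"
      using that yz assms by (simp add: k_def divide_strict_right_mono)
    have r: "k a b y < k a b z" if "a < y" "z < v"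
    proof -
      have "(v - z) * ((v - b) / (v - a)) < (v - y) * ((v - b) / (v - a))"
        by (rule mult_strict_right_mono) (use that yz assms in auto)
      then show ?thesis using that yz assms by (simp add: k_def)
    qed
    have out: "k a b y = y" if "y \<le> u \<or> v \<le> y" for y using that by (simp add: k_def)
    consider "y \<le> u \<or> v \<le> y" | "u < y" "y \<le> a" | "a < y" "y < v" by linarith
    note Y = this
    consider "z \<le> u \<or> v \<le> z" | "u < z" "z \<le> a" | "a < z" "z < v" by linarith
    note Z = this
    show ?thesis
      using Y Z l r low[OF assms, of y] high[OF assms, of y] low[OF assms, of z] high[OF assms, of z]
        out[of y] out[of z] yz assms
      by (smt (verit))
  qed
  show ?thesis
  proof
    show "strict_mono (k a b)" using mono by (simp add: strict_mono_def)
    show "surj (k a b)" using inv[of b a] assms by (metis surj_def)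
    show "k a b a = b" using assms by (simp add: k_def)
    show "\<And>y. y \<le> u \<or> v \<le> y \<Longrightarrow> k a b y = y" by (simp add: k_def)
  qed
qed

text \<open>
  Two families of polynomials, paired up by \<open>\<Gamma>\<close>, show the same sign pattern along the line precisely
  if some increasing bijection transports the signs. Its composability is what makes this encoding
  preferable to sorted lists of roots.
\<close>

definition sign_chart :: "(real poly \<times> real poly) set \<Rightarrow> (real \<Rightarrow> real) \<Rightarrow> bool" where
  "sign_chart \<Gamma> h \<longleftrightarrow> strict_mono h \<and> surj h \<and>
     (\<forall>(p, q) \<in> \<Gamma>. \<forall>t. sgn (poly p t) = sgn (poly q (h t)))"

lemma sign_chartD:
  assumes "sign_chart \<Gamma> h"
  shows "strict_mono h" "surj h" "(p, q) \<in> \<Gamma> \<Longrightarrow> sgn (poly p t) = sgn (poly q (h t))"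
  using assms by (auto simp: sign_chart_def)

lemma sign_chart_zero_iff:
  assumes "sign_chart \<Gamma> h" "(p, q) \<in> \<Gamma>"
  shows "poly p t = 0 \<longleftrightarrow> poly q (h t) = 0"
  using sign_chartD(3)[OF assms, of t] by (metis sgn_eq_0_iff)

lemma finite_set_gap:
  fixes Z :: "real set"
  assumes "finite Z" "t \<notin> Z" "l \<in> Z" "l < t" "r \<in> Z" "t < r"
  obtains a b where "a \<in> Z" "b \<in> Z" "a < t" "t < b" "\<And>z. z \<in> Z \<Longrightarrow> z \<le> a \<or> b \<le> z"
proof -
  let ?A = "{z \<in> Z. z < t}" and ?B = "{z \<in> Z. t < z}"
  have A: "finite ?A" "?A \<noteq> {}" and B: "finite ?B" "?B \<noteq> {}" using assms by auto
  show ?thesis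
  proof
    show "Max ?A \<in> Z" "Max ?A < t" using Max_in[OF A] by auto
    show "Min ?B \<in> Z" "t < Min ?B" using Min_in[OF B] by auto
    fix z assume "z \<in> Z"
    then show "z \<le> Max ?A \<or> Min ?B \<le> z"
      using Max_ge[OF A(1)] Min_le[OF B(1)] assms(2) by (metis (mono_tags, lifting) linorder_neqE mem_Collect_eq)
  qed
qed

text \<open>
  The chart \<open>h0\<close> is adapted to \<open>p\<close> and \<open>q\<close> gap by gap. The finite set \<open>Z\<close> marks points where the signs of
  \<open>p\<close> and \<open>q\<close> are already known to correspond; it contains the roots of the family, in particular those
  of \<open>p'\<close>. So each gap between neighbouring marks contains at most one root of \<open>p\<close>, and a root of \<open>p\<close>
  exists there if and only if the signs at the two marks are opposite, hence if and only if \<open>q\<close> has a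
  root in the image of the gap. Moving the image of the root of \<open>p\<close> onto the root of \<open>q\<close> within the gap
  changes no sign of the old family, as that family has no roots inside. The hypotheses that roots
  of \<open>p\<close> and \<open>q\<close> have marks on either side leave no roots in the unbounded gaps.
\<close>

lemma sign_chart_extend_by_marks:
  fixes p q :: "real poly"
  assumes chart: "sign_chart \<Gamma> h0"
    and deriv: "(pderiv p, pderiv q) \<in> \<Gamma>"
    and "p \<noteq> 0" "finite Z" "Z \<noteq> {}"
    and roots: "\<And>g g' z. (g, g') \<in> \<Gamma> \<Longrightarrow> poly g z = 0 \<Longrightarrow> z \<in> Z"
    and sgn_Z: "\<And>z. z \<in> Z \<Longrightarrow> sgn (poly p z) = sgn (poly q (h0 z))"
    and p_bounds: "\<And>t. poly p t = 0 \<Longrightarrow> \<exists>a\<in>Z. a < t" "\<And>t. poly p t = 0 \<Longrightarrow> \<exists>b\<in>Z. t < b"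
    and q_bounds: "\<And>t. poly q (h0 t) = 0 \<Longrightarrow> \<exists>a\<in>Z. a < t" "\<And>t. poly q (h0 t) = 0 \<Longrightarrow> \<exists>b\<in>Z. t < b"
  shows "\<exists>h. sign_chart (insert (p, q) \<Gamma>) h"
proof -
  define good where "good h \<longleftrightarrow> sign_chart \<Gamma> h \<and> (\<forall>z\<in>Z. h z = h0 z)" for h
  have no_deriv_root: "poly (pderiv p) y \<noteq> 0"
    if "\<And>z. z \<in> Z \<Longrightarrow> z \<le> a \<or> b \<le> z" "a < y" "y < b" for a b y
    using roots[OF deriv, of y] that by force
  have good_sgn: "sgn (poly p z) = sgn (poly q (h z))" if "good h" "z \<in> Z" for h z
    using that sgn_Z by (auto simp: good_def)
  have preimage: "\<exists>s. a < s \<and> s < b \<and> y = h s" if "good h" "h a < y" "y < h b" for h a b y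
  proof -
    have h: "strict_mono h" "surj h" using that sign_chartD[of \<Gamma> h] by (auto simp: good_def)
    then obtain s where "y = h s" by (metis surjD)
    then show ?thesis using that h strict_mono_less[OF h(1)] by auto
  qed
  have no_root_image: "poly g' y \<noteq> 0"
    if asm: "good h" "\<And>z. z \<in> Z \<Longrightarrow> z \<le> a \<or> b \<le> z" "(g, g') \<in> \<Gamma>" "h a < y" "y < h b" for h a b g g' y
  proof -
    obtain s where s: "a < s" "s < b" "y = h s" using preimage[OF asm(1,4,5)] by blast
    then have "poly g s \<noteq> 0" using roots[OF asm(3), of s] asm(2) by force
    then show ?thesis using sign_chart_zero_iff[of \<Gamma> h g g' s] asm s by (simp add: good_def)
  qed
  \<comment> \<open>The gaps with a root of \<open>p\<close> are treated one at a time: a move inside one gap leaves the image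
  of every mark and of the roots in the other gaps in place.\<close>
  have adapt: "\<exists>h. good h \<and> (\<forall>t\<in>R. poly q (h t) = 0)"
    if "finite R" "R \<subseteq> {t. poly p t = 0} - Z" for R
    using that
  proof (induction R)
    case empty
    then show ?case using chart by (auto simp: good_def)
  next
    case (insert x R)
    then obtain h where h: "good h" "\<And>t. t \<in> R \<Longrightarrow> poly q (h t) = 0" by auto
    then have sm: "strict_mono h" and surj: "surj h" and ch: "sign_chart \<Gamma> h"
      using sign_chartD[of \<Gamma> h] by (auto simp: good_def)
    have x: "poly p x = 0" "x \<notin> Z" using insert.prems by auto
    obtain l r where "l \<in> Z" "l < x" "r \<in> Z" "x < r" using p_bounds[OF x(1)] by blast
    then obtain a b where ab: "a \<in> Z" "b \<in> Z" "a < x" "x < b"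
      and gap: "\<And>z. z \<in> Z \<Longrightarrow> z \<le> a \<or> b \<le> z"
      using finite_set_gap[OF \<open>finite Z\<close> x(2)] by metis
    have "poly p a * poly p b < 0"
      by (rule poly_opposite_signs_around_root[OF ab(3,4) x(1)]) (use no_deriv_root gap in blast)
    then have "sgn (poly p a) * sgn (poly p b) < 0" by (simp flip: sgn_mult)
    then have "poly q (h a) * poly q (h b) < 0"
      using good_sgn[OF h(1) ab(1)] good_sgn[OF h(1) ab(2)] by (simp flip: sgn_mult)
    moreover have "h a < h b" using sm ab by (simp add: strict_mono_less)
    ultimately obtain y where y: "h a < y" "y < h b" "poly q y = 0" using poly_IVT by blast
    have hx: "h a < h x" "h x < h b" using sm ab by (simp_all add: strict_mono_less)
    obtain k where k: "strict_mono k" "surj k" "k (h x) = y"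
      and k_id: "\<And>s. s \<le> h a \<or> h b \<le> s \<Longrightarrow> k s = s"
      using strict_mono_surj_moving_point[OF hx y(1,2)] by metis
    have k_out: "k (h z) = h z" if "z \<le> a \<or> b \<le> z" for z
      using k_id[of "h z"] that sm by (simp add: strict_mono_less_eq)
    have "sgn (poly g t) = sgn (poly g' (k (h t)))" if gg: "(g, g') \<in> \<Gamma>" for g g' t
    proof (cases "t \<le> a \<or> b \<le> t")
      case True
      then show ?thesis using k_out sign_chartD(3)[OF ch gg] by simp
    next
      case False
      then have t: "h a < h t" "h t < h b" using sm by (simp_all add: strict_mono_less)
      moreover have "k (h a) < k (h t)" "k (h t) < k (h b)"
        using k(1) t by (simp_all add: strict_mono_less)
      then have kt: "h a < k (h t)" "k (h t) < h b" using k_id by auto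
      have nr: "poly g' s \<noteq> 0" if "h a < s" "s < h b" for s
        using no_root_image[OF h(1) gap gg that] by blast
      have "sgn (poly g' (h t)) = sgn (poly g' (k (h t)))"
      proof (cases "h t \<le> k (h t)")
        case True
        then show ?thesis by (rule sgn_poly_eq_if_no_root) (use t kt nr in force)
      next
        case False
        then have "k (h t) \<le> h t" by simp
        then show ?thesis using sgn_poly_eq_if_no_root[of "k (h t)" "h t" g'] t kt nr by force
      qed
      then show ?thesis using sign_chartD(3)[OF ch gg] by simp
    qed
    moreover have "strict_mono (k \<circ> h)" using sm k(1) by (simp add: strict_mono_def)
    moreover have "surj (k \<circ> h)" using surj k(2) by (rule comp_surj)
    ultimately have "sign_chart \<Gamma> (k \<circ> h)" by (auto simp: sign_chart_def)
    moreover have "(k \<circ> h) z = h0 z" if "z \<in> Z" for z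
      using k_out[of z] gap[OF that] h(1) that by (simp add: good_def)
    moreover have "poly q ((k \<circ> h) t) = 0" if "t \<in> insert x R" for t
    proof (cases "t = x")
      case True then show ?thesis using k y by simp
    next
      case False
      have pt: "poly p t = 0" using that insert.prems by auto
      have "t \<le> a \<or> b \<le> t"
      proof (rule ccontr)
        assume "\<not> (t \<le> a \<or> b \<le> t)"
        then have t: "a < t" "t < b" by auto
        have "\<exists>y. min t x < y \<and> y < max t x \<and> poly (pderiv p) y = 0"
          by (rule poly_Rolle) (use False pt x in \<open>auto simp: min_def max_def\<close>)
        then show False using no_deriv_root[OF gap] t ab by (metis less_trans max_less_iff_conj min_less_iff_conj)
      qed
      then show ?thesis using k_out[of t] h(2) that False by simp
    qed
    ultimately show ?case unfolding good_def by blast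
  qed
  have "finite ({t. poly p t = 0} - Z)" using poly_roots_finite[OF \<open>p \<noteq> 0\<close>] by simp
  from adapt[OF this subset_refl] obtain h where h: "good h"
    and h_roots: "\<And>t. poly p t = 0 \<Longrightarrow> t \<notin> Z \<Longrightarrow> poly q (h t) = 0" by auto
  have sm: "strict_mono h" and surj: "surj h" and ch: "sign_chart \<Gamma> h"
    using sign_chartD[of \<Gamma> h] h by (auto simp: good_def)
  note mono = strict_mono_less[OF sm] strict_mono_less_eq[OF sm]
  have h0_sm: "strict_mono h0" "surj h0" using chart by (auto simp: sign_chart_def)
  have q_below: "\<exists>a\<in>Z. h a < y" if "poly q y = 0" for y
  proof -
    obtain t where "y = h0 t" using h0_sm by (metis surjD)
    then show ?thesis using q_bounds(1)[of t] that h h0_sm(1) by (auto simp: good_def strict_mono_less)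
  qed
  have q_above: "\<exists>a\<in>Z. y < h a" if "poly q y = 0" for y
  proof -
    obtain t where "y = h0 t" using h0_sm by (metis surjD)
    then show ?thesis using q_bounds(2)[of t] that h h0_sm(1) by (auto simp: good_def strict_mono_less)
  qed
  have up: "sgn (poly p t) = sgn (poly q (h t))" if "a \<in> Z" "a \<le> t"
    "\<And>s. a \<le> s \<Longrightarrow> s \<le> t \<Longrightarrow> poly p s \<noteq> 0" "\<And>y. h a \<le> y \<Longrightarrow> y \<le> h t \<Longrightarrow> poly q y \<noteq> 0" for a t
  proof -
    have "sgn (poly p a) = sgn (poly p t)" by (rule sgn_poly_eq_if_no_root) (use that in auto)
    moreover have "sgn (poly q (h a)) = sgn (poly q (h t))"
      by (rule sgn_poly_eq_if_no_root) (use that mono in auto)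
    ultimately show ?thesis using good_sgn[OF h that(1)] by simp
  qed
  have down: "sgn (poly p t) = sgn (poly q (h t))" if "b \<in> Z" "t \<le> b"
    "\<And>s. t \<le> s \<Longrightarrow> s \<le> b \<Longrightarrow> poly p s \<noteq> 0" "\<And>y. h t \<le> y \<Longrightarrow> y \<le> h b \<Longrightarrow> poly q y \<noteq> 0" for b t
  proof -
    have "sgn (poly p t) = sgn (poly p b)" by (rule sgn_poly_eq_if_no_root) (use that in auto)
    moreover have "sgn (poly q (h t)) = sgn (poly q (h b))"
      by (rule sgn_poly_eq_if_no_root) (use that mono in auto)
    ultimately show ?thesis using good_sgn[OF h that(1)] by simp
  qed
  have "sgn (poly p t) = sgn (poly q (h t))" for t
  proof -
    consider "t \<in> Z" | "t \<notin> Z" "poly p t = 0" | "t \<notin> Z" "poly p t \<noteq> 0" "\<And>z. z \<in> Z \<Longrightarrow> t < z"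
      | "t \<notin> Z" "poly p t \<noteq> 0" "\<And>z. z \<in> Z \<Longrightarrow> z < t"
      | l r where "t \<notin> Z" "poly p t \<noteq> 0" "l \<in> Z" "l < t" "r \<in> Z" "t < r"
      by (metis linorder_neqE)
    then show ?thesis
    proof cases
      case 1 then show ?thesis using good_sgn[OF h] by simp
    next
      case 2 then show ?thesis using h_roots by simp
    next
      case 3
      let ?m = "Min Z"
      have m: "?m \<in> Z" "\<And>z. z \<in> Z \<Longrightarrow> ?m \<le> z" using assms(4,5) by auto
      show ?thesis
      proof (rule down[OF m(1)])
        show "poly p s \<noteq> 0" if "s \<le> ?m" for s using p_bounds(1)[of s] m(2) that by force
        show "poly q y \<noteq> 0" if "y \<le> h ?m" for y
          using q_below[of y] m(2) mono(2) that by (meson leD order_trans)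
        show "t \<le> ?m" using 3(3)[OF m(1)] by simp
      qed
    next
      case 4
      let ?m = "Max Z"
      have m: "?m \<in> Z" "\<And>z. z \<in> Z \<Longrightarrow> z \<le> ?m" using assms(4,5) by auto
      show ?thesis
      proof (rule up[OF m(1)])
        show "poly p s \<noteq> 0" if "?m \<le> s" for s using p_bounds(2)[of s] m(2) that by force
        show "poly q y \<noteq> 0" if "h ?m \<le> y" for y
          using q_above[of y] m(2) mono(2) that by (meson leD order_trans)
        show "?m \<le> t" using 4(3)[OF m(1)] by simp
      qed
    next
      case 5
      then obtain a b where ab: "a \<in> Z" "b \<in> Z" "a < t" "t < b"
        and gap: "\<And>z. z \<in> Z \<Longrightarrow> z \<le> a \<or> b \<le> z"
        using finite_set_gap[OF \<open>finite Z\<close> 5(1)] by metis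
      note dp = no_deriv_root[OF gap] and dq = no_root_image[OF h gap deriv]
      have one_p: "x = y" if "poly p x = 0" "poly p y = 0" "a \<le> x" "x \<le> b" "a \<le> y" "y \<le> b" for x y
      proof (rule ccontr)
        assume "x \<noteq> y"
        then have "\<exists>s. min x y < s \<and> s < max x y \<and> poly (pderiv p) s = 0"
          by (intro poly_Rolle) (use that in \<open>auto simp: min_def max_def\<close>)
        then obtain s where "min x y < s" "s < max x y" "poly (pderiv p) s = 0" by blast
        then show False using dp[of s] that by (auto simp: min_def max_def split: if_splits)
      qed
      have one_q: "x = y" if "poly q x = 0" "poly q y = 0" "h a \<le> x" "x \<le> h b" "h a \<le> y" "y \<le> h b" for x y
      proof (rule ccontr)
        assume "x \<noteq> y"
        then have "\<exists>s. min x y < s \<and> s < max x y \<and> poly (pderiv q) s = 0"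
          by (intro poly_Rolle) (use that in \<open>auto simp: min_def max_def\<close>)
        then obtain s where "min x y < s" "s < max x y" "poly (pderiv q) s = 0" by blast
        then show False using dq[of s] that by (auto simp: min_def max_def split: if_splits)
      qed
      show ?thesis
      proof (cases "\<exists>x. a < x \<and> x < b \<and> poly p x = 0")
        \<comment> \<open>By the choice of \<open>h\<close> the unique root of \<open>p\<close> in the gap is mapped to the unique root of \<open>q\<close>,
        so the mark on the same side of it decides both signs at \<open>t\<close>.\<close>
        case True
        then obtain x where x: "a < x" "x < b" "poly p x = 0" by blast
        then have "x \<notin> Z" using gap by force
        then have hx: "poly q (h x) = 0" using h_roots x by simp
        have hab: "h a < h x" "h x < h b" "h a < h t" "h t < h b" using x ab mono by auto
        have "t \<noteq> x" using x 5 by auto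
        then consider "t < x" | "x < t" by linarith
        then show ?thesis
        proof cases
          case 1
          then have "h t < h x" using mono by simp
          show ?thesis
          proof (rule up[OF ab(1)])
            show "poly p s \<noteq> 0" if "a \<le> s" "s \<le> t" for s using one_p[of s x] that 1 x by force
            show "poly q y \<noteq> 0" if "h a \<le> y" "y \<le> h t" for y
              using one_q[of y "h x"] that \<open>h t < h x\<close> hab hx by force
          qed (use ab in auto)
        next
          case 2
          then have "h x < h t" using mono by simp
          show ?thesis
          proof (rule down[OF ab(2)])
            show "poly p s \<noteq> 0" if "t \<le> s" "s \<le> b" for s using one_p[of s x] that 2 x by force
            show "poly q y \<noteq> 0" if "h t \<le> y" "y \<le> h b" for y
              using one_q[of y "h x"] that \<open>h x < h t\<close> hab hx by force
          qed (use ab in auto)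
        qed
      next
        \<comment> \<open>Neither \<open>p\<close> nor \<open>q\<close> has a root in the gap, and by Rolle at least one of the marks is no root of \<open>p\<close>.\<close>
        case False
        have hab: "h a < h t" "h t < h b" using ab mono by auto
        have q_none: "poly q y \<noteq> 0" if y: "h a < y" "y < h b" for y
        proof
          assume "poly q y = 0"
          then have "poly q (h a) * poly q (h b) < 0"
            by (intro poly_opposite_signs_around_root[OF y]) (use dq in auto)
          then have "sgn (poly q (h a)) * sgn (poly q (h b)) < 0" by (simp flip: sgn_mult)
          then have "sgn (poly p a) * sgn (poly p b) < 0"
            using good_sgn[OF h ab(1)] good_sgn[OF h ab(2)] by simp
          then have "poly p a * poly p b < 0" by (simp flip: sgn_mult)
          then show False using poly_IVT[of a b p] ab False by force
        qed
        have "poly p a \<noteq> 0 \<or> poly p b \<noteq> 0" using one_p[of a b] ab by force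
        then show ?thesis
        proof
          assume pa: "poly p a \<noteq> 0"
          then have qa: "poly q (h a) \<noteq> 0" using good_sgn[OF h ab(1)] by (metis sgn_eq_0_iff)
          show ?thesis
          proof (rule up[OF ab(1)])
            show "poly p s \<noteq> 0" if "a \<le> s" "s \<le> t" for s
              using False pa that ab by (cases "s = a") force+
            show "poly q y \<noteq> 0" if "h a \<le> y" "y \<le> h t" for y
              using q_none[of y] qa that hab by (cases "y = h a") force+
          qed (use ab in auto)
        next
          assume pb: "poly p b \<noteq> 0"
          then have qb: "poly q (h b) \<noteq> 0" using good_sgn[OF h ab(2)] by (metis sgn_eq_0_iff)
          show ?thesis
          proof (rule down[OF ab(2)])
            show "poly p s \<noteq> 0" if "t \<le> s" "s \<le> b" for s
              using False pb that ab by (cases "s = b") force+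
            show "poly q y \<noteq> 0" if "h t \<le> y" "y \<le> h b" for y
              using q_none[of y] qb that hab by (cases "y = h b") force+
          qed (use ab in auto)
        qed
      qed
    qed
  qed
  then have "sign_chart (insert (p, q) \<Gamma>) h" using ch by (auto simp: sign_chart_def)
  then show ?thesis by blast
qed

text \<open>
  At a root \<open>z\<close> of a member \<open>g\<close>, the sign of \<open>p\<close> can be read off the remainder \<open>c p - s g\<close>, whose value
  there is \<open>c p(z)\<close>. Far to the left and to the right it can be read off the degree and the leading
  coefficient. This provides the marks needed to extend the chart.
\<close>

lemma sign_chart_extend:
  fixes p q :: "real poly"
  assumes chart: "sign_chart (\<Gamma> \<union> \<Gamma>') h"
    and fin: "finite \<Gamma>" and nz: "\<And>g g'. (g, g') \<in> \<Gamma> \<Longrightarrow> g \<noteq> 0"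
    and deriv: "(pderiv p, pderiv q) \<in> \<Gamma>"
    and deg: "degree p = degree q" and lc: "sgn (lead_coeff p) = sgn (lead_coeff q)" and "p \<noteq> 0"
    and red: "\<And>g g'. (g, g') \<in> \<Gamma> \<Longrightarrow> \<exists>c c' s s'. c \<noteq> 0 \<and> sgn c = sgn c' \<and>
                (smult c p - s * g, smult c' q - s' * g') \<in> \<Gamma>'"
  shows "\<exists>h. sign_chart (insert (p, q) \<Gamma>) h"
proof -
  have sm: "strict_mono h" and surj: "surj h" using chart by (auto simp: sign_chart_def)
  have ch: "sign_chart \<Gamma> h" using chart by (auto simp: sign_chart_def)
  have "q \<noteq> 0" using lc \<open>p \<noteq> 0\<close> by (metis leading_coeff_0_iff sgn_eq_0_iff)
  define Z where "Z = (\<Union>(g, g')\<in>\<Gamma>. {z. poly g z = 0})"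
  \<comment> \<open>Two artificial marks outside of \<open>B\<close> turn the unbounded gaps into root-free ones.\<close>
  define B where "B = Z \<union> {z. poly p z = 0} \<union> {z. poly q (h z) = 0}"
  have finZ: "finite Z" using fin nz poly_roots_finite by (auto simp: Z_def)
  have "{z. poly q (h z) = 0} = h -` {y. poly q y = 0}" by auto
  then have "finite {z. poly q (h z) = 0}"
    using finite_vimageI[OF poly_roots_finite[OF \<open>q \<noteq> 0\<close>] strict_mono_imp_inj_on[OF sm]] by simp
  then have finB: "finite B" using finZ poly_roots_finite[OF \<open>p \<noteq> 0\<close>] by (simp add: B_def)
  obtain M where M: "\<And>z. z \<in> B \<Longrightarrow> z < M"
    using finB by (metis finite_has_maximal2 bdd_above_finite bdd_above_def gt_ex less_le_trans le_less_trans)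
  obtain m where m: "\<And>z. z \<in> B \<Longrightarrow> m < z"
    using finB by (metis bdd_below_finite bdd_below_def lt_ex less_le_trans)
  have q_right: "poly q y \<noteq> 0" if "h M \<le> y" for y
  proof
    assume y: "poly q y = 0"
    obtain s where s: "y = h s" using surj by (metis surjD)
    then have "s \<in> B" using y by (simp add: B_def)
    then have "h s < h M" using M sm by (simp add: strict_mono_less)
    then show False using that s by simp
  qed
  have q_left: "poly q y \<noteq> 0" if "y \<le> h m" for y
  proof
    assume y: "poly q y = 0"
    obtain s where s: "y = h s" using surj by (metis surjD)
    then have "s \<in> B" using y by (simp add: B_def)
    then have "h m < h s" using m sm by (simp add: strict_mono_less)
    then show False using that s by simp
  qed
  have p_right: "poly p y \<noteq> 0" if "M \<le> y" for y using M[of y] that by (auto simp: B_def)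
  have p_left: "poly p y \<noteq> 0" if "y \<le> m" for y using m[of y] that by (auto simp: B_def)
  show ?thesis
  proof (rule sign_chart_extend_by_marks[OF ch deriv \<open>p \<noteq> 0\<close>])
    show "finite (insert m (insert M Z))" using finZ by simp
    show "insert m (insert M Z) \<noteq> {}" by simp
    show "z \<in> insert m (insert M Z)" if "(g, g') \<in> \<Gamma>" "poly g z = 0" for g g' z
      using that by (auto simp: Z_def)
    show "sgn (poly p z) = sgn (poly q (h z))" if z: "z \<in> insert m (insert M Z)" for z
    proof -
      consider "z = m" | "z = M" | "z \<in> Z" using z by auto
      then show ?thesis
      proof cases
        case 1
        then show ?thesis
          using sgn_poly_before_roots[of m p] sgn_poly_before_roots[of "h m" q] p_left q_left deg lc by simp
      next
        case 2
        then show ?thesis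
          using sgn_poly_beyond_roots[of M p] sgn_poly_beyond_roots[of "h M" q] p_right q_right lc by simp
      next
        case 3
        then obtain g g' where g: "(g, g') \<in> \<Gamma>" "poly g z = 0" by (auto simp: Z_def)
        then have g': "poly g' (h z) = 0" using sign_chart_zero_iff[OF ch] by blast
        obtain c c' s s' where c: "c \<noteq> 0" "sgn c = sgn c'"
          and r: "(smult c p - s * g, smult c' q - s' * g') \<in> \<Gamma>'" using red[OF g(1)] by blast
        have "sgn c * sgn (poly p z) = sgn c' * sgn (poly q (h z))"
          using sign_chartD(3)[OF chart UnI2[OF r], of z] g g' by (simp add: sgn_mult)
        then show ?thesis using c by (auto simp: sgn_eq_0_iff)
      qed
    qed
    show "\<exists>a\<in>insert m (insert M Z). a < t" if "poly p t = 0" for t using m[of t] that by (auto simp: B_def)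
    show "\<exists>b\<in>insert m (insert M Z). t < b" if "poly p t = 0" for t using M[of t] that by (auto simp: B_def)
    show "\<exists>a\<in>insert m (insert M Z). a < t" if "poly q (h t) = 0" for t using m[of t] that by (auto simp: B_def)
    show "\<exists>b\<in>insert m (insert M Z). t < b" if "poly q (h t) = 0" for t using M[of t] that by (auto simp: B_def)
  qed
qed

section \<open>Families of polynomials with polynomial coefficients\<close>

text \<open>
  Polynomial functions of an assignment of real values to variables. Variables of an arbitrary type
  allow coordinates to be eliminated one after another without changing the ambient space.
\<close>

inductive_set polynomial_maps :: "(('v \<Rightarrow> real) \<Rightarrow> real) set" where
  const: "(\<lambda>e. c) \<in> polynomial_maps"
| var: "(\<lambda>e. e v) \<in> polynomial_maps"
| add: "a \<in> polynomial_maps \<Longrightarrow> b \<in> polynomial_maps \<Longrightarrow> (\<lambda>e. a e + b e) \<in> polynomial_maps"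
| mult: "a \<in> polynomial_maps \<Longrightarrow> b \<in> polynomial_maps \<Longrightarrow> (\<lambda>e. a e * b e) \<in> polynomial_maps"

lemma polynomial_maps_diff:
  assumes "a \<in> polynomial_maps" "b \<in> polynomial_maps"
  shows "(\<lambda>e. a e - b e) \<in> polynomial_maps"
  using polynomial_maps.add[OF assms(1) polynomial_maps.mult[OF polynomial_maps.const[of "- 1"] assms(2)]] by simp

lemma polynomial_maps_sum:
  assumes "finite I" "\<And>i. i \<in> I \<Longrightarrow> f i \<in> polynomial_maps"
  shows "(\<lambda>e. \<Sum>i\<in>I. f i e) \<in> polynomial_maps"
  using assms by (induction I) (auto intro: polynomial_maps.intros)

text \<open>
  The bound \<open>d\<close> is a formal degree: the coefficient of index \<open>d\<close> may vanish for some parameters.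
\<close>

definition poly_over_maps :: "nat \<Rightarrow> (('v \<Rightarrow> real) \<Rightarrow> real poly) \<Rightarrow> bool" where
  "poly_over_maps d p \<longleftrightarrow>
     (\<forall>e. degree (p e) \<le> d) \<and> (\<forall>j. (\<lambda>e. coeff (p e) j) \<in> polynomial_maps)"

lemma poly_over_mapsD:
  assumes "poly_over_maps d p"
  shows "degree (p e) \<le> d" "(\<lambda>e. coeff (p e) j) \<in> polynomial_maps"
  using assms by (auto simp: poly_over_maps_def)

lemma poly_over_maps_pderiv:
  assumes "poly_over_maps d p"
  shows "poly_over_maps (d - 1) (\<lambda>e. pderiv (p e))"
proof -
  have "(\<lambda>e. coeff (pderiv (p e)) j) \<in> polynomial_maps" for j
    unfolding coeff_pderiv by (intro polynomial_maps.intros poly_over_mapsD[OF assms])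
  then show ?thesis
    using poly_over_mapsD(1)[OF assms] by (simp add: poly_over_maps_def degree_pderiv diff_le_mono)
qed

lemma degree_le_pred_if_coeff_zero:
  assumes "0 < d" "degree p \<le> d" "coeff p d = 0"
  shows "degree p \<le> d - 1"
  using assms by (metis One_nat_def Suc_pred coeff_0_degree_minus_1 diff_le_mono le_antisym le_degree leD leI le_neq_implies_less less_Suc_eq_le)

lemma poly_over_maps_truncate:
  assumes "poly_over_maps d p" "0 < d"
  shows "poly_over_maps (d - 1) (\<lambda>e. p e - monom (coeff (p e) d) d)"
proof -
  have "(\<lambda>e. coeff (p e - monom (coeff (p e) d) d) j) \<in> polynomial_maps" for j
    using poly_over_mapsD(2)[OF assms(1)] polynomial_maps.const[of 0]
    by (cases "j = d") (simp_all)
  moreover have "degree (p e - monom (coeff (p e) d) d) \<le> d - 1" for e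
    using poly_over_mapsD(1)[OF assms(1), of e] assms(2)
    by (intro degree_le_pred_if_coeff_zero degree_diff_le) (auto intro: degree_monom_le)
  ultimately show ?thesis by (simp add: poly_over_maps_def)
qed

text \<open>
  One step of pseudo-division with the formal leading coefficients. It cancels the coefficient of
  index \<open>d\<close>, and no division by a parameter function occurs. One step suffices for the elimination,
  because any combination of \<open>p\<close> and \<open>g\<close> in which \<open>p\<close> carries a nonvanishing factor reveals the sign
  of \<open>p\<close> at the roots of \<open>g\<close>, and only the formal degree \<open>d\<close> has to decrease.
\<close>

definition euclid_step :: "nat \<Rightarrow> real poly \<Rightarrow> nat \<Rightarrow> real poly \<Rightarrow> real poly" where
  "euclid_step d p d' g = smult (coeff g d') p - monom (coeff p d) (d - d') * g"

lemma poly_over_maps_euclid_step: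
  assumes p: "poly_over_maps d p" and g: "poly_over_maps d' g" and "0 < d" "d' \<le> d"
  shows "poly_over_maps (d - 1) (\<lambda>e. euclid_step d (p e) d' (g e))"
proof -
  have "(\<lambda>e. coeff (euclid_step d (p e) d' (g e)) j) \<in> polynomial_maps" for j
    unfolding euclid_step_def coeff_diff coeff_smult coeff_monom_mult
    by (cases "d - d' \<le> j")
      (simp_all add: polynomial_maps_diff polynomial_maps.intros poly_over_mapsD[OF p] poly_over_mapsD[OF g])
  moreover have "degree (euclid_step d (p e) d' (g e)) \<le> d - 1" for e
  proof (rule degree_le_pred_if_coeff_zero[OF \<open>0 < d\<close>])
    have "degree (monom (coeff (p e) d) (d - d') * g e) \<le> (d - d') + d'"
      by (rule order_trans[OF degree_mult_le add_mono])
        (auto simp: degree_monom_le poly_over_mapsD(1)[OF g])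
    then show "degree (euclid_step d (p e) d' (g e)) \<le> d"
      unfolding euclid_step_def using poly_over_mapsD(1)[OF p, of e] \<open>d' \<le> d\<close>
      by (intro degree_diff_le) (auto intro: order_trans[OF degree_smult_le])
    show "coeff (euclid_step d (p e) d' (g e)) d = 0"
      using \<open>d' \<le> d\<close> by (simp add: euclid_step_def coeff_monom_mult)
  qed
  ultimately show ?thesis by (simp add: poly_over_maps_def)
qed

definition fibre_pairs :: "('a \<Rightarrow> real poly) set \<Rightarrow> 'a \<Rightarrow> 'a \<Rightarrow> (real poly \<times> real poly) set" where
  "fibre_pairs F e e' = (\<lambda>p. (p e, p e')) ` F"

lemma fibre_pairs_sndE:
  assumes "(g, g') \<in> fibre_pairs (snd ` N) e e'"
  obtains d q where "(d, q) \<in> N" "g = q e" "g' = q e'"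
  using assms by (auto simp: fibre_pairs_def)

lemma sign_chart_mono: "sign_chart \<Gamma> h \<Longrightarrow> \<Gamma>' \<subseteq> \<Gamma> \<Longrightarrow> sign_chart \<Gamma>' h"
  by (fastforce simp: sign_chart_def)

lemma sign_chart_insert:
  "sign_chart (insert (p, q) \<Gamma>) h \<longleftrightarrow>
     (\<forall>t. sgn (poly p t) = sgn (poly q (h t))) \<and> sign_chart \<Gamma> h"
  unfolding sign_chart_def by blast

lemma fibre_pairs_insert: "fibre_pairs (insert p F) e e' = insert (p e, p e') (fibre_pairs F e e')"
  by (simp add: fibre_pairs_def)

definition signs_determine_chart ::
    "(('v \<Rightarrow> real) \<Rightarrow> real) set \<Rightarrow> (('v \<Rightarrow> real) \<Rightarrow> real poly) set \<Rightarrow> bool" where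
  "signs_determine_chart C F \<longleftrightarrow> finite C \<and> C \<subseteq> polynomial_maps \<and>
     (\<forall>e e'. (\<forall>a\<in>C. sgn (a e) = sgn (a e')) \<longrightarrow> (\<exists>h. sign_chart (fibre_pairs F e e') h))"

lemma signs_determine_chartD:
  assumes "signs_determine_chart C F"
  shows "finite C" "C \<subseteq> polynomial_maps"
    "(\<And>a. a \<in> C \<Longrightarrow> sgn (a e) = sgn (a e')) \<Longrightarrow> \<exists>h. sign_chart (fibre_pairs F e e') h"
  using assms unfolding signs_determine_chart_def by blast+

lemma signs_determine_chart_constant:
  assumes p: "poly_over_maps 0 p" and C: "signs_determine_chart C F"
  shows "signs_determine_chart (insert (\<lambda>e. coeff (p e) 0) C) (insert p F)"
  unfolding signs_determine_chart_def
proof (intro conjI allI impI)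
  show "finite (insert (\<lambda>e. coeff (p e) 0) C)" using signs_determine_chartD(1)[OF C] by simp
  show "insert (\<lambda>e. coeff (p e) 0) C \<subseteq> polynomial_maps"
    using signs_determine_chartD(2)[OF C] poly_over_mapsD(2)[OF p] by simp
  fix e e' assume agree: "\<forall>a\<in>insert (\<lambda>e. coeff (p e) 0) C. sgn (a e) = sgn (a e')"
  then obtain h where h: "sign_chart (fibre_pairs F e e') h"
    using signs_determine_chartD(3)[OF C, of e e'] by auto
  have const: "poly (p e) t = coeff (p e) 0" for e t
  proof -
    have "degree (p e) = 0" using poly_over_mapsD(1)[OF p, of e] by simp
    then obtain c where "p e = [:c:]" by (rule degree_eq_zeroE)
    then show ?thesis by simp
  qed
  have "sgn (poly (p e) t) = sgn (poly (p e') (h t))" for t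
    using agree by (simp add: const)
  then show "\<exists>h. sign_chart (fibre_pairs (insert p F) e e') h"
    using h unfolding fibre_pairs_insert sign_chart_insert by blast
qed

text \<open>
  The induction step of the elimination. If some formal leading coefficient vanishes at the parameters,
  the family coincides with the one in which that polynomial is truncated. If none vanishes, the
  formal degrees are the true ones, and a polynomial \<open>p\<close> can be added back to the remaining family by
  means of its derivative and the remainders. Which of the cases applies depends on the signs of the
  leading coefficients, so adding these to the parameter functions of all cases suffices.
\<close>

lemma signs_determine_chart_by_cases:
  fixes M :: "(nat \<times> (('v \<Rightarrow> real) \<Rightarrow> real poly)) set"
  assumes fin: "finite M" and over: "\<And>d g. (d, g) \<in> M \<Longrightarrow> poly_over_maps d g"
    and Dp: "(D, p) \<in> M" "0 < D"
    and T: "\<And>d g. (d, g) \<in> M \<Longrightarrow>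
      signs_determine_chart (T (d, g)) (insert (\<lambda>e. g e - monom (coeff (g e) d) d) (snd ` (M - {(d, g)})))"
    and N: "N = insert (D - 1, \<lambda>e. pderiv (p e)) (M - {(D, p)})"
    and C: "signs_determine_chart C (snd ` N \<union> (\<lambda>(d, g) e. euclid_step D (p e) d (g e)) ` N)"
  shows "\<exists>C. signs_determine_chart C (snd ` M)"
proof -
  define L where "L = (\<lambda>(d, g) e. coeff (g e) d) ` M"
  have L_in: "(\<lambda>e. coeff (g e) d) \<in> L" if "(d, g) \<in> M" for d g
    unfolding L_def by (rule image_eqI[OF _ that]) simp
  define K where "K = L \<union> (\<Union>dg\<in>M. T dg) \<union> C"
  have "signs_determine_chart K (snd ` M)"
    unfolding signs_determine_chart_def
  proof (intro conjI allI impI)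
    have T_dg: "finite (T dg) \<and> T dg \<subseteq> polynomial_maps" if "dg \<in> M" for dg
      using signs_determine_chartD(1,2)[OF T[of "fst dg" "snd dg"]] that by simp
    then have "finite (\<Union>dg\<in>M. T dg)" using fin by simp
    then show "finite K"
      unfolding K_def L_def using signs_determine_chartD(1)[OF C] fin by simp
    have "L \<subseteq> polynomial_maps"
    proof (unfold L_def, rule image_subsetI)
      fix dg assume "dg \<in> M"
      then have "poly_over_maps (fst dg) (snd dg)" using over[of "fst dg" "snd dg"] by simp
      then show "(case dg of (d, g) \<Rightarrow> \<lambda>e. coeff (g e) d) \<in> polynomial_maps"
        using poly_over_mapsD(2) by (simp add: split_beta)
    qed
    moreover have "(\<Union>dg\<in>M. T dg) \<subseteq> polynomial_maps" using T_dg by blast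
    ultimately show "K \<subseteq> polynomial_maps"
      unfolding K_def using signs_determine_chartD(2)[OF C] by simp
    fix e e' assume agree: "\<forall>a\<in>K. sgn (a e) = sgn (a e')"
    have lead: "sgn (coeff (g e) d) = sgn (coeff (g e') d)" if "(d, g) \<in> M" for d g
      using bspec[OF agree, of "\<lambda>e. coeff (g e) d"] L_in[OF that] by (simp add: K_def)
    show "\<exists>h. sign_chart (fibre_pairs (snd ` M) e e') h"
    proof (cases "\<exists>d g. (d, g) \<in> M \<and> coeff (g e) d = 0")
      case True
      then obtain d g where dg: "(d, g) \<in> M" "coeff (g e) d = 0" by blast
      let ?tr = "\<lambda>e. g e - monom (coeff (g e) d) d"
      have "coeff (g e') d = 0" using lead[OF dg(1)] dg(2) by (metis sgn_eq_0_iff)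
      then have tr: "?tr e = g e" "?tr e' = g e'" using dg by auto
      have "\<exists>h. sign_chart (fibre_pairs (insert ?tr (snd ` (M - {(d, g)}))) e e') h"
        by (rule signs_determine_chartD(3)[OF T[OF dg(1)]]) (use agree dg(1) in \<open>auto simp: K_def\<close>)
      moreover have "M = insert (d, g) (M - {(d, g)})" using dg(1) by blast
      then have "snd ` M = insert g (snd ` (M - {(d, g)}))" by (metis image_insert snd_conv)
      ultimately show ?thesis unfolding fibre_pairs_insert tr by (metis fibre_pairs_insert)
    next
      case False
      then have nz: "coeff (g e) d \<noteq> 0" "coeff (g e') d \<noteq> 0" if "(d, g) \<in> M" for d g
        using that lead[OF that] by (metis sgn_eq_0_iff)+
      have p_over: "poly_over_maps D p" using over[OF Dp(1)] by simp
      have deg: "degree (p e) = D" "degree (p e') = D"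
        using nz[OF Dp(1)] poly_over_mapsD(1)[OF p_over] by (meson le_antisym le_degree)+
      let ?step = "\<lambda>(d, g) e. euclid_step D (p e) d (g e)"
      let ?\<Gamma> = "fibre_pairs (snd ` N) e e'" and ?\<Gamma>' = "fibre_pairs (?step ` N) e e'"
      have "\<exists>h. sign_chart (fibre_pairs (snd ` N \<union> ?step ` N) e e') h"
        by (rule signs_determine_chartD(3)[OF C]) (use agree in \<open>auto simp: K_def\<close>)
      then obtain h where h: "sign_chart (?\<Gamma> \<union> ?\<Gamma>') h" by (auto simp: fibre_pairs_def image_Un)
      have N_lead: "coeff (g e) d \<noteq> 0 \<and> sgn (coeff (g e) d) = sgn (coeff (g e') d)" if "(d, g) \<in> N" for d g
      proof (cases "(d, g) \<in> M")
        case True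
        then show ?thesis using nz lead by blast
      next
        case False
        then have "d = D - 1" "g = (\<lambda>e. pderiv (p e))" using that by (auto simp: N)
        then show ?thesis using nz[OF Dp(1)] lead[OF Dp(1)] Dp(2) by (simp add: coeff_pderiv sgn_mult)
      qed
      have "\<exists>h. sign_chart (insert (p e, p e') ?\<Gamma>) h"
      proof (rule sign_chart_extend[OF h])
        show "finite ?\<Gamma>" using fin by (simp add: fibre_pairs_def N)
        show "g \<noteq> 0" if gg': "(g, g') \<in> ?\<Gamma>" for g g'
        proof -
          obtain d q where "(d, q) \<in> N" "g = q e" using fibre_pairs_sndE[OF gg'] by metis
          then show ?thesis using N_lead[of d q] by auto
        qed
        show "(pderiv (p e), pderiv (p e')) \<in> ?\<Gamma>" by (simp add: fibre_pairs_def N)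
        show "degree (p e) = degree (p e')" "sgn (lead_coeff (p e)) = sgn (lead_coeff (p e'))"
          using deg lead[OF Dp(1)] by simp_all
        show "p e \<noteq> 0" using nz[OF Dp(1)] by force
        fix g g' assume "(g, g') \<in> ?\<Gamma>"
        then obtain d q where dq: "(d, q) \<in> N" "g = q e" "g' = q e'" by (rule fibre_pairs_sndE)
        have "(\<lambda>e. euclid_step D (p e) d (q e)) \<in> ?step ` N" using dq(1) by force
        then have "(euclid_step D (p e) d g, euclid_step D (p e') d g') \<in> ?\<Gamma>'"
          unfolding fibre_pairs_def dq(2,3) by (rule rev_image_eqI) simp
        then show "\<exists>c c' s s'. c \<noteq> 0 \<and> sgn c = sgn c' \<and> (smult c (p e) - s * g, smult c' (p e') - s' * g') \<in> ?\<Gamma>'"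
          using N_lead[OF dq(1)] dq(2,3) unfolding euclid_step_def by blast
      qed
      moreover have "snd ` M \<subseteq> insert p (snd ` N)" by (force simp: N)
      then have "fibre_pairs (snd ` M) e e' \<subseteq> insert (p e, p e') ?\<Gamma>"
        unfolding fibre_pairs_insert[symmetric] unfolding fibre_pairs_def by (rule image_mono)
      ultimately show ?thesis using sign_chart_mono by blast
    qed
  qed
  then show ?thesis by blast
qed

lemma set_mset_remove1_subset: "set_mset M - {x} \<subseteq> set_mset (M - {#x#})"
proof (cases "x \<in># M")
  case True
  then have "set_mset M = insert x (set_mset (M - {#x#}))"
    by (metis insert_DiffM set_mset_add_mset_insert)
  then show ?thesis by blast
next
  case False
  then show ?thesis by (simp add: diff_single_trivial)
qed

lemma signs_determine_chart_mono:
  assumes "signs_determine_chart C F" "F' \<subseteq> F"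
  shows "signs_determine_chart C F'"
proof -
  have "fibre_pairs F' e e' \<subseteq> fibre_pairs F e e'" for e e'
    using assms(2) by (auto simp: fibre_pairs_def)
  then show ?thesis using assms(1) sign_chart_mono unfolding signs_determine_chart_def by meson
qed

text \<open>
  Both kinds of replacement exchange one polynomial of formal degree \<open>d\<close> for finitely many of smaller
  formal degree, provided that \<open>p\<close> is chosen with maximal \<open>d\<close>; so the multiset of formal degrees
  decreases in the multiset order. Polynomials of formal degree \<open>0\<close> are parameter functions
  themselves.
\<close>

theorem finitely_many_signs_determine_chart:
  fixes M :: "(nat \<times> (('v \<Rightarrow> real) \<Rightarrow> real poly)) multiset"
  assumes "\<And>d p. (d, p) \<in># M \<Longrightarrow> poly_over_maps d p"
  shows "\<exists>C. signs_determine_chart C (snd ` set_mset M)"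
  using assms
proof (induction M rule: wf_induct_rule[OF wf_mult[OF wf_measure[of fst]]])
  case (1 M)
  note over = "1.prems"
  have IH: "\<exists>C. signs_determine_chart C (snd ` (set_mset M - {(d, p)} \<union> set_mset K))"
    if dp: "(d, p) \<in># M" and K: "\<forall>(d', g)\<in>set_mset K. d' < d \<and> poly_over_maps d' g" for d p K
  proof -
    have "(M - {#(d, p)#} + K, M - {#(d, p)#} + {#(d, p)#}) \<in> mult (Wellfounded.measure fst)"
      by (rule one_step_implies_mult) (use K in auto)
    then have less: "(M - {#(d, p)#} + K, M) \<in> mult (Wellfounded.measure fst)" using dp by simp
    have over': "poly_over_maps d' g" if "(d', g) \<in># M - {#(d, p)#} + K" for d' g
      using that over[of d' g] K by (auto dest: in_diffD)
    obtain C where "signs_determine_chart C (snd ` set_mset (M - {#(d, p)#} + K))"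
      using "1.IH"[OF less over'] by blast
    moreover have "snd ` (set_mset M - {(d, p)} \<union> set_mset K) \<subseteq> snd ` set_mset (M - {#(d, p)#} + K)"
      using set_mset_remove1_subset[of M "(d, p)"] by auto
    ultimately show ?thesis using signs_determine_chart_mono by blast
  qed
  consider "M = {#}" | p where "(0, p) \<in># M" | "M \<noteq> {#}" "\<And>d p. (d, p) \<in># M \<Longrightarrow> 0 < d"
    by (metis not_gr0)
  then show ?case
  proof cases
    case 1
    have "sign_chart {} (\<lambda>t. t)" by (simp add: sign_chart_def strict_mono_def)
    then have "signs_determine_chart {} {}" unfolding signs_determine_chart_def fibre_pairs_def by simp blast
    then show ?thesis using 1 by (simp, intro exI)
  next
    case 2
    obtain C where "signs_determine_chart C (snd ` (set_mset M - {(0, p)} \<union> set_mset {#}))"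
      using IH[OF 2, of "{#}"] by auto
    then have "signs_determine_chart C (snd ` (set_mset M - {(0, p)}))" by simp
    from signs_determine_chart_constant[OF over[OF 2] this]
    have "signs_determine_chart (insert (\<lambda>e. coeff (p e) 0) C) (snd ` insert (0, p) (set_mset M - {(0, p)}))"
      by (simp only: image_insert snd_conv)
    then show ?thesis unfolding insert_Diff[OF 2] by blast
  next
    case 3
    let ?tr = "\<lambda>(d, p) e. p e - monom (coeff (p e) d) d"
    have "\<exists>C. signs_determine_chart C (insert (?tr dp) (snd ` (set_mset M - {dp})))" if "dp \<in># M" for dp
    proof -
      obtain d p where dp: "dp = (d, p)" by force
      have dp_in: "(d, p) \<in># M" using that dp by simp
      have smaller: "\<forall>(d', g)\<in>set_mset {#(d - 1, ?tr (d, p))#}. d' < d \<and> poly_over_maps d' g"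
        using poly_over_maps_truncate[OF over[OF dp_in] 3(2)[OF dp_in]] 3(2)[OF dp_in] by simp
      show ?thesis
        using IH[of d p "{#(d - 1, ?tr (d, p))#}", OF dp_in smaller] unfolding dp by simp
    qed
    then have "\<forall>dp\<in>set_mset M. \<exists>C. signs_determine_chart C (insert (?tr dp) (snd ` (set_mset M - {dp})))"
      by (rule ballI)
    from bchoice[OF this] obtain T where T: "\<forall>dp\<in>set_mset M.
        signs_determine_chart (T dp) (insert (?tr dp) (snd ` (set_mset M - {dp})))" by (rule exE)
    have "finite (fst ` set_mset M)" "fst ` set_mset M \<noteq> {}" using 3 by auto
    from Max_in[OF this] obtain D p where Dp: "(D, p) \<in># M" and D: "D = Max (fst ` set_mset M)" by auto
    have D_max: "d \<le> D" if "(d, g) \<in># M" for d g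
      unfolding D using that by (intro Max_ge) force+
    have D_pos: "0 < D" using 3(2)[OF Dp] .
    define N where "N = insert (D - 1, \<lambda>e. pderiv (p e)) (set_mset M - {(D, p)})"
    have N_over: "poly_over_maps d g \<and> d \<le> D" if "(d, g) \<in> N" for d g
      using that over D_max poly_over_maps_pderiv[OF over[OF Dp]] by (auto simp: N_def)
    let ?step = "\<lambda>(d, g). (D - 1, \<lambda>e. euclid_step D (p e) d (g e))"
    let ?K = "add_mset (D - 1, \<lambda>e. pderiv (p e)) (image_mset ?step (mset_set N))"
    have "finite N" by (simp add: N_def)
    have K: "set_mset ?K = insert (D - 1, \<lambda>e. pderiv (p e)) (?step ` N)" using \<open>finite N\<close> by simp
    have smaller: "\<forall>(d', g)\<in>set_mset ?K. d' < D \<and> poly_over_maps d' g"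
      unfolding K
    proof (rule ballI, rule case_prodI2)
      fix dg :: "nat \<times> (('v \<Rightarrow> real) \<Rightarrow> real poly)" and d' g
      assume "dg \<in> insert (D - 1, \<lambda>e. pderiv (p e)) (?step ` N)" "dg = (d', g)"
      then have "(d', g) \<in> insert (D - 1, \<lambda>e. pderiv (p e)) (?step ` N)" by simp
      then consider "(d', g) = (D - 1, \<lambda>e. pderiv (p e))" | "(d', g) \<in> ?step ` N" by (rule insertE)
      then show "d' < D \<and> poly_over_maps d' g"
      proof cases
        case 1
        then show ?thesis using poly_over_maps_pderiv[OF over[OF Dp]] D_pos by simp
      next
        case 2
        then obtain dq where "dq \<in> N" "(d', g) = ?step dq" by (rule imageE)
        moreover obtain d q where dq: "dq = (d, q)" by force
        ultimately have N: "(d, q) \<in> N" and g: "d' = D - 1" "g = (\<lambda>e. euclid_step D (p e) d (q e))" by simp_all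
        show ?thesis
          unfolding g using poly_over_maps_euclid_step[OF over[OF Dp], of d q] N_over[OF N] D_pos by simp
      qed
    qed
    have union: "set_mset M - {(D, p)} \<union> set_mset ?K = N \<union> ?step ` N"
      unfolding K Un_insert_right Un_insert_left[symmetric] N_def[symmetric] by (rule refl)
    have image: "snd ` (N \<union> ?step ` N) = snd ` N \<union> (\<lambda>(d, g) e. euclid_step D (p e) d (g e)) ` N"
      by (simp add: image_Un image_image split_beta)
    obtain C where C: "signs_determine_chart C (snd ` N \<union> (\<lambda>(d, g) e. euclid_step D (p e) d (g e)) ` N)"
      using IH[of D p ?K, OF Dp smaller] unfolding union image by (elim exE)
    show ?thesis
    proof (rule signs_determine_chart_by_cases[where T = T, OF _ _ Dp D_pos _ N_def C])
      show "poly_over_maps d g" if "(d, g) \<in># M" for d g using over that by blast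
      show "signs_determine_chart (T (d, g)) (insert (\<lambda>e. g e - monom (coeff (g e) d) d) (snd ` (set_mset M - {(d, g)})))"
        if "(d, g) \<in># M" for d g using bspec[OF T that] by simp
    qed simp
  qed
qed

section \<open>Projections of sign-determined sets\<close>

text \<open>
  By sorting parameters according to the possible sign vectors, these are the finite unions of sets
  given by polynomial equations and strict inequalities. Stated semantically, the property passes to
  complements and intersections by merely uniting the sets of polynomials.
\<close>

definition sign_determined :: "('v \<Rightarrow> real) set \<Rightarrow> bool" where
  "sign_determined D \<longleftrightarrow> (\<exists>P. finite P \<and> P \<subseteq> polynomial_maps \<and>
     (\<forall>e e'. (\<forall>a\<in>P. sgn (a e) = sgn (a e')) \<longrightarrow> (e \<in> D \<longleftrightarrow> e' \<in> D)))"

lemma sign_determinedI: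
  assumes "finite P" "P \<subseteq> polynomial_maps"
    "\<And>e e'. (\<And>a. a \<in> P \<Longrightarrow> sgn (a e) = sgn (a e')) \<Longrightarrow> e \<in> D \<longleftrightarrow> e' \<in> D"
  shows "sign_determined D"
  unfolding sign_determined_def by (intro exI[of _ P] conjI allI impI assms(1,2), rule assms(3)) blast

lemma sign_determinedE:
  assumes "sign_determined D"
  obtains P where "finite P" "P \<subseteq> polynomial_maps"
    "\<And>e e'. (\<And>a. a \<in> P \<Longrightarrow> sgn (a e) = sgn (a e')) \<Longrightarrow> e \<in> D \<longleftrightarrow> e' \<in> D"
  using assms unfolding sign_determined_def by metis

lemma sign_determined_sgn_condition:
  assumes "a \<in> polynomial_maps"
  shows "sign_determined {e. R (sgn (a e))}"
  by (rule sign_determinedI[of "{a}"]) (use assms in auto)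

lemma sign_determined_pos: "a \<in> polynomial_maps \<Longrightarrow> sign_determined {e. a e > 0}"
  using sign_determined_sgn_condition[of a "\<lambda>s. s > 0"] by simp

lemma sign_determined_zero: "a \<in> polynomial_maps \<Longrightarrow> sign_determined {e. a e = 0}"
  using sign_determined_sgn_condition[of a "\<lambda>s. s = 0"] by (simp add: sgn_eq_0_iff)

lemma sign_determined_nonneg: "a \<in> polynomial_maps \<Longrightarrow> sign_determined {e. a e \<ge> 0}"
  using sign_determined_sgn_condition[of a "\<lambda>s. s \<ge> 0"] by simp

lemma sign_determined_Compl: "sign_determined D \<Longrightarrow> sign_determined (- D)"
  unfolding sign_determined_def by auto

lemma sign_determined_Int:
  assumes "sign_determined D" "sign_determined E"
  shows "sign_determined (D \<inter> E)"
proof -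
  obtain P where P: "finite P" "P \<subseteq> polynomial_maps"
    "\<And>e e'. (\<And>a. a \<in> P \<Longrightarrow> sgn (a e) = sgn (a e')) \<Longrightarrow> e \<in> D \<longleftrightarrow> e' \<in> D"
    using sign_determinedE[OF assms(1)] by metis
  obtain Q where Q: "finite Q" "Q \<subseteq> polynomial_maps"
    "\<And>e e'. (\<And>a. a \<in> Q \<Longrightarrow> sgn (a e) = sgn (a e')) \<Longrightarrow> e \<in> E \<longleftrightarrow> e' \<in> E"
    using sign_determinedE[OF assms(2)] by metis
  show ?thesis
    by (rule sign_determinedI[of "P \<union> Q"]) (use P(1,2) Q(1,2) in simp_all, use P(3) Q(3) in blast)
qed

lemma sign_determined_UNIV: "sign_determined UNIV"
  by (rule sign_determinedI[of "{}"]) auto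

lemma sign_determined_INT:
  assumes "finite I" "\<And>i. i \<in> I \<Longrightarrow> sign_determined (D i)"
  shows "sign_determined (\<Inter>i\<in>I. D i)"
  using assms by (induction I) (auto intro: sign_determined_Int sign_determined_UNIV)

lemma sign_determined_UN:
  assumes "finite I" "\<And>i. i \<in> I \<Longrightarrow> sign_determined (D i)"
  shows "sign_determined (\<Union>i\<in>I. D i)"
proof -
  have "sign_determined (- (\<Inter>i\<in>I. - D i))"
    by (intro sign_determined_Compl sign_determined_INT assms)
  then show ?thesis by simp
qed

lemma polynomial_map_as_poly_in_variable:
  assumes "a \<in> polynomial_maps"
  shows "\<exists>d p. poly_over_maps d p \<and> (\<forall>e t. poly (p e) t = a (e(v := t)))"
  using assms
proof induction
  case (const c)
  have "poly_over_maps 0 (\<lambda>e. [:c:])" unfolding poly_over_maps_def by (simp add: polynomial_maps.const)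
  then show ?case by (intro exI[of _ 0] exI[of _ "\<lambda>e. [:c:]"]) simp
next
  case (var w)
  show ?case
  proof (cases "w = v")
    case True
    have "poly_over_maps 1 (\<lambda>e. [:0, 1:])" unfolding poly_over_maps_def by (simp add: polynomial_maps.const)
    then show ?thesis
      using True by (intro exI[of _ 1] exI[of _ "\<lambda>e. [:0, 1:]"]) simp
  next
    case False
    have "(\<lambda>e. coeff [:e w:] j) \<in> polynomial_maps" for j
      by (cases j) (simp_all add: polynomial_maps.intros)
    then have "poly_over_maps 0 (\<lambda>e. [:e w:])" unfolding poly_over_maps_def by (simp del: coeff_pCons)
    then show ?thesis
      using False by (intro exI[of _ 0] exI[of _ "\<lambda>e. [:e w:]"]) simp
  qed
next
  case (add a b)
  obtain d p where p: "poly_over_maps d p" "\<And>e t. poly (p e) t = a (e(v := t))" using add.IH(1) by metis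
  obtain d' q where q: "poly_over_maps d' q" "\<And>e t. poly (q e) t = b (e(v := t))" using add.IH(2) by metis
  note * = p q
  have "degree (p e + q e) \<le> max d d'" for e
    using poly_over_mapsD(1)[OF *(1), of e] poly_over_mapsD(1)[OF *(3), of e] by (intro degree_add_le) auto
  then have "poly_over_maps (max d d') (\<lambda>e. p e + q e)"
    using * by (simp add: poly_over_maps_def polynomial_maps.add)
  moreover have "poly (p e + q e) t = a (e(v := t)) + b (e(v := t))" for e t
    by (simp only: poly_add *(2,4))
  ultimately show ?case by blast
next
  case (mult a b)
  obtain d p where p: "poly_over_maps d p" "\<And>e t. poly (p e) t = a (e(v := t))" using mult.IH(1) by metis
  obtain d' q where q: "poly_over_maps d' q" "\<And>e t. poly (q e) t = b (e(v := t))" using mult.IH(2) by metis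
  note * = p q
  have "degree (p e * q e) \<le> d + d'" for e
    using poly_over_mapsD(1)[OF *(1), of e] poly_over_mapsD(1)[OF *(3), of e]
    by (meson add_mono degree_mult_le order_trans)
  moreover have "(\<lambda>e. coeff (p e * q e) j) \<in> polynomial_maps" for j
    unfolding coeff_mult
    by (intro polynomial_maps_sum polynomial_maps.mult poly_over_mapsD(2)[OF *(1)] poly_over_mapsD(2)[OF *(3)]) simp
  ultimately have "poly_over_maps (d + d') (\<lambda>e. p e * q e)" by (simp add: poly_over_maps_def)
  moreover have "poly (p e * q e) t = a (e(v := t)) * b (e(v := t))" for e t
    by (simp only: poly_mult *(2,4))
  ultimately show ?case by blast
qed

text \<open>
  The Tarski-Seidenberg theorem. The polynomials describing \<open>D\<close> are regarded as polynomials in the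
  variable \<open>v\<close>. If two assignments give the same signs to the functions of the preceding section, a chart
  \<open>h\<close> carries a witness \<open>t\<close> for one of them to the witness \<open>h t\<close> for the other.
\<close>

theorem sign_determined_ex_variable:
  assumes "sign_determined D"
  shows "sign_determined {e. \<exists>t. e(v := t) \<in> D}"
proof -
  obtain P where P: "finite P" "P \<subseteq> polynomial_maps"
    and det: "\<And>e e'. (\<And>a. a \<in> P \<Longrightarrow> sgn (a e) = sgn (a e')) \<Longrightarrow> e \<in> D \<longleftrightarrow> e' \<in> D"
    using sign_determinedE[OF assms] by metis
  have "\<forall>a\<in>P. \<exists>dp. poly_over_maps (fst dp) (snd dp) \<and> (\<forall>e t. poly (snd dp e) t = a (e(v := t)))"
  proof
    fix a assume "a \<in> P"
    then have "a \<in> polynomial_maps" using P(2) by blast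
    from polynomial_map_as_poly_in_variable[OF this, of v] obtain d p
      where "poly_over_maps d p" "\<forall>e t. poly (p e) t = a (e(v := t))" by blast
    then show "\<exists>dp. poly_over_maps (fst dp) (snd dp) \<and> (\<forall>e t. poly (snd dp e) t = a (e(v := t)))"
      by (intro exI[of _ "(d, p)"]) (simp only: fst_conv snd_conv simp_thms)
  qed
  from bchoice[OF this] obtain p where
    p: "\<forall>a\<in>P. poly_over_maps (fst (p a)) (snd (p a)) \<and> (\<forall>e t. poly (snd (p a) e) t = a (e(v := t)))"
    by (elim exE)
  have p1: "poly_over_maps (fst (p a)) (snd (p a))" if "a \<in> P" for a using p that by blast
  have p2: "poly (snd (p a) e) t = a (e(v := t))" if "a \<in> P" for a e t using p that by blast
  let ?M = "image_mset p (mset_set P)"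
  have "poly_over_maps d q" if "(d, q) \<in># ?M" for d q
  proof -
    obtain a where "a \<in> P" "p a = (d, q)" using \<open>(d, q) \<in># ?M\<close> P(1) by auto
    then show ?thesis using p1[of a] by simp
  qed
  from finitely_many_signs_determine_chart[OF this]
  obtain C where C: "finite C" "C \<subseteq> polynomial_maps"
    and chart: "\<And>e e'. (\<And>a. a \<in> C \<Longrightarrow> sgn (a e) = sgn (a e')) \<Longrightarrow>
      \<exists>h. sign_chart (fibre_pairs (snd ` set_mset ?M) e e') h"
    using signs_determine_chartD by metis
  have half: "\<exists>t. e'(v := t) \<in> D"
    if agree: "\<And>a. a \<in> C \<Longrightarrow> sgn (a e) = sgn (a e')" and t: "e(v := t) \<in> D" for e e' t
  proof -
    obtain h where h: "sign_chart (fibre_pairs (snd ` set_mset ?M) e e') h" using chart agree by blast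
    have "sgn (a (e(v := t))) = sgn (a (e'(v := h t)))" if a: "a \<in> P" for a
    proof -
      have "snd (p a) \<in> snd ` set_mset ?M" using a P(1) by simp
      then have "(snd (p a) e, snd (p a) e') \<in> fibre_pairs (snd ` set_mset ?M) e e'"
        unfolding fibre_pairs_def by (rule rev_image_eqI) (rule refl)
      from sign_chartD(3)[OF h this, of t] show ?thesis by (simp only: p2[OF a])
    qed
    then have "e'(v := h t) \<in> D" using det[of "e(v := t)" "e'(v := h t)"] t by blast
    then show ?thesis by blast
  qed
  show ?thesis
  proof (rule sign_determinedI[OF C])
    fix e e' :: "'a \<Rightarrow> real"
    assume "\<And>a. a \<in> C \<Longrightarrow> sgn (a e) = sgn (a e')"
    then show "e \<in> {e. \<exists>t. e(v := t) \<in> D} \<longleftrightarrow> e' \<in> {e. \<exists>t. e(v := t) \<in> D}"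
      using half[of e e'] half[of e' e] by auto
  qed
qed

lemma sign_determined_ex_variables:
  assumes "finite I" "sign_determined D"
  shows "sign_determined {e. \<exists>u. override_on e u I \<in> D}"
  using assms(1)
proof (induction I)
  case empty
  then show ?case using assms(2) by simp
next
  case (insert v I)
  have "override_on e u (insert v I) = override_on (e(v := u v)) u I" for e u :: "'a \<Rightarrow> real"
    using insert.hyps(2) by (auto simp: override_on_def)
  moreover have "override_on (e(v := t)) u I = override_on e (u(v := t)) (insert v I)" for e u :: "'a \<Rightarrow> real" and t
    using insert.hyps(2) by (auto simp: override_on_def)
  ultimately have "{e. \<exists>u. override_on e u (insert v I) \<in> D} =
      {e. \<exists>t. e(v := t) \<in> {e. \<exists>u. override_on e u I \<in> D}}" by (auto, metis+)
  then show ?case using sign_determined_ex_variable[OF insert.IH, of v] by simp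
qed

section \<open>Frontiers of fibres lie on an algebraic curve\<close>

text \<open>
  A polynomial function restricted to two of the variables, the others being \<open>0\<close>, is represented as a
  polynomial in the variable \<open>w\<close> with coefficients in the variable \<open>v\<close>. As \<open>v\<close> and \<open>w\<close> are arbitrary,
  either variable can be made the outer one.
\<close>

lemma polynomial_map_bivariate:
  assumes "a \<in> polynomial_maps"
  shows "\<exists>P :: real poly poly. \<forall>t r.
    poly (poly P [:r:]) t = a (\<lambda>u. if u = v then t else if u = w then r else 0)"
  using assms
proof induction
  case (const c)
  show ?case by (intro exI[of _ "[:[:c:]:]"]) simp
next
  case (var u)
  consider "u = v" | "u \<noteq> v" "u = w" | "u \<noteq> v" "u \<noteq> w" by blast
  then show ?case
  proof cases
    case 1
    then show ?thesis by (intro exI[of _ "[:[:0, 1:]:]"]) simp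
  next
    case 2
    then show ?thesis by (intro exI[of _ "[:0, 1:]"]) simp
  next
    case 3
    then show ?thesis by (intro exI[of _ 0]) simp
  qed
next
  case (add a b)
  then obtain P Q :: "real poly poly" where
    "\<forall>t r. poly (poly P [:r:]) t = a (\<lambda>u. if u = v then t else if u = w then r else 0)"
    "\<forall>t r. poly (poly Q [:r:]) t = b (\<lambda>u. if u = v then t else if u = w then r else 0)" by blast
  then show ?case by (intro exI[of _ "P + Q"]) simp
next
  case (mult a b)
  then obtain P Q :: "real poly poly" where
    "\<forall>t r. poly (poly P [:r:]) t = a (\<lambda>u. if u = v then t else if u = w then r else 0)"
    "\<forall>t r. poly (poly Q [:r:]) t = b (\<lambda>u. if u = v then t else if u = w then r else 0)" by blast
  then show ?case by (intro exI[of _ "P * Q"]) simp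
qed

lemma eventually_sgn_poly_eq:
  fixes q :: "real poly"
  assumes "poly q r \<noteq> 0"
  shows "\<forall>\<^sub>F s in nhds r. sgn (poly q s) = sgn (poly q r)"
proof -
  have lim: "(poly q \<longlongrightarrow> poly q r) (nhds r)"
    using poly_isCont[of r q] by (simp add: isCont_def tendsto_at_iff_tendsto_nhds)
  show ?thesis
  proof (cases "poly q r > 0")
    case True
    then have "\<forall>\<^sub>F s in nhds r. poly q s > 0" by (rule order_tendstoD(1)[OF lim])
    then show ?thesis by eventually_elim (use True in simp)
  next
    case False
    then have neg: "poly q r < 0" using assms by simp
    then have "\<forall>\<^sub>F s in nhds r. poly q s < 0" by (rule order_tendstoD(2)[OF lim])
    then show ?thesis by eventually_elim (use neg in simp)
  qed
qed

text \<open>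
  At a frontier point some describing polynomial that does not vanish identically on the plane must
  be zero: otherwise all signs, and with them membership in \<open>D\<close>, would be constant nearby. The product
  of these finitely many polynomials defines the curve. It is provided both as a polynomial \<open>P\<close> in \<open>r\<close>
  over polynomials in \<open>t\<close> and as a polynomial \<open>Q\<close> in \<open>t\<close> over polynomials in \<open>r\<close>, because the growth
  estimates for large and for small \<open>t\<close> need different readings.
\<close>

lemma frontier_of_fibre_on_curve:
  fixes D :: "('v \<Rightarrow> real) set"
  assumes "sign_determined D" "v \<noteq> w"
  shows "\<exists>P Q :: real poly poly. P \<noteq> 0 \<and> Q \<noteq> 0 \<and>
    (\<forall>t. \<forall>r \<in> frontier {r. (\<lambda>u. if u = v then t else if u = w then r else 0) \<in> D}.
        poly (poly P [:r:]) t = 0 \<and> poly (poly Q [:t:]) r = 0)"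
proof -
  define E where "E t r = (\<lambda>u. if u = v then t else if u = w then r else (0::real))" for t r
  have E_swap: "E t r = (\<lambda>u. if u = w then r else if u = v then t else 0)" for t r
    using \<open>v \<noteq> w\<close> by (auto simp: E_def)
  obtain F where F: "finite F" "F \<subseteq> polynomial_maps"
    and det: "\<And>e e'. (\<And>a. a \<in> F \<Longrightarrow> sgn (a e) = sgn (a e')) \<Longrightarrow> e \<in> D \<longleftrightarrow> e' \<in> D"
    using sign_determinedE[OF assms(1)] by metis
  define G where "G = {a \<in> F. \<exists>t r. a (E t r) \<noteq> 0}"
  have "\<forall>a\<in>G. \<exists>P :: real poly poly. \<forall>t r. poly (poly P [:r:]) t = a (E t r)"
    using polynomial_map_bivariate[of _ v w] F(2) unfolding G_def E_def by blast
  from bchoice[OF this] obtain P where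
    P: "\<forall>a\<in>G. \<forall>t r. poly (poly (P a) [:r:]) t = a (E t r)" by (elim exE)
  have "\<forall>a\<in>G. \<exists>Q :: real poly poly. \<forall>t r. poly (poly Q [:t:]) r = a (E t r)"
    using polynomial_map_bivariate[of _ w v] F(2) unfolding G_def E_swap by blast
  from bchoice[OF this] obtain Q where
    Q: "\<forall>a\<in>G. \<forall>t r. poly (poly (Q a) [:t:]) r = a (E t r)" by (elim exE)
  have finG: "finite G" using F(1) by (simp add: G_def)
  have "P a \<noteq> 0 \<and> Q a \<noteq> 0" if a: "a \<in> G" for a
  proof -
    obtain t r where "a (E t r) \<noteq> 0" using a by (auto simp: G_def)
    then have "poly (poly (P a) [:r:]) t \<noteq> 0" "poly (poly (Q a) [:t:]) r \<noteq> 0" using P Q a by simp_all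
    then show ?thesis by auto
  qed
  then have nz: "prod P G \<noteq> 0" "prod Q G \<noteq> 0" using finG by simp_all
  have zero: "\<exists>a\<in>G. a (E t r) = 0" if r: "r \<in> frontier {r. E t r \<in> D}" for t r
  proof (rule ccontr)
    assume no: "\<not> (\<exists>a\<in>G. a (E t r) = 0)"
    have "\<forall>\<^sub>F s in nhds r. \<forall>a\<in>G. sgn (a (E t s)) = sgn (a (E t r))"
    proof (rule eventually_ball_finite[OF finG], rule ballI)
      fix a assume a: "a \<in> G"
      then have "poly (poly (Q a) [:t:]) r \<noteq> 0" using no Q by auto
      from eventually_sgn_poly_eq[OF this] show "\<forall>\<^sub>F s in nhds r. sgn (a (E t s)) = sgn (a (E t r))"
        using Q a by simp
    qed
    then have "\<forall>\<^sub>F s in nhds r. E t s \<in> D \<longleftrightarrow> E t r \<in> D"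
    proof eventually_elim
      case (elim s)
      show ?case
      proof (rule det)
        fix a assume "a \<in> F"
        then show "sgn (a (E t s)) = sgn (a (E t r))"
          by (cases "a \<in> G") (use elim in \<open>auto simp: G_def\<close>)
      qed
    qed
    then obtain U where U: "open U" "r \<in> U" and U_iff: "\<forall>s\<in>U. E t s \<in> D \<longleftrightarrow> E t r \<in> D"
      unfolding eventually_nhds by blast
    show False
    proof (cases "E t r \<in> D")
      case True
      then have "U \<subseteq> {r. E t r \<in> D}" using U_iff by blast
      then have "r \<in> interior {r. E t r \<in> D}" using U by (intro interiorI)
      then show False using r by (simp add: frontier_def)
    next
      case False
      then have "U \<inter> {r. E t r \<in> D} = {}" using U_iff by blast
      then have "U \<inter> closure {r. E t r \<in> D} = {}" using U(1) by (simp add: open_Int_closure_eq_empty)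
      then show False using r U(2) by (auto simp: frontier_def)
    qed
  qed
  have "poly (poly (prod P G) [:r:]) t = 0 \<and> poly (poly (prod Q G) [:t:]) r = 0"
    if r: "r \<in> frontier {r. E t r \<in> D}" for t r
  proof -
    obtain a where a: "a \<in> G" "a (E t r) = 0" using zero[OF r] by blast
    then have "poly (poly (P a) [:r:]) t = 0" "poly (poly (Q a) [:t:]) r = 0" using P Q by simp_all
    then show ?thesis using a(1) finG by (auto simp: poly_prod)
  qed
  then show ?thesis using nz unfolding E_def by blast
qed

section \<open>Growth of functions on an algebraic curve\<close>

lemma abs_poly_le_on_unit:
  fixes p :: "real poly"
  shows "\<exists>B\<ge>0. \<forall>x. 0 \<le> x \<and> x \<le> 1 \<longrightarrow> \<bar>poly p x\<bar> \<le> B"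
proof (induction p)
  case 0
  then show ?case by (intro exI[of _ 0]) simp
next
  case (pCons a p)
  then obtain B where B: "B \<ge> 0" "\<forall>x. 0 \<le> x \<and> x \<le> 1 \<longrightarrow> \<bar>poly p x\<bar> \<le> B" by blast
  have "\<bar>a + x * poly p x\<bar> \<le> \<bar>a\<bar> + B" if "0 \<le> x" "x \<le> 1" for x
  proof -
    have "x * \<bar>poly p x\<bar> \<le> 1 * B" using that B by (intro mult_mono) auto
    moreover have "\<bar>x * poly p x\<bar> = x * \<bar>poly p x\<bar>" using that by (simp add: abs_mult)
    ultimately show ?thesis by linarith
  qed
  then show ?case using B(1) by (intro exI[of _ "\<bar>a\<bar> + B"]) simp
qed

lemma abs_bivariate_poly_le_on_unit:
  fixes Q :: "real poly poly"
  shows "\<exists>B\<ge>0. \<forall>t r. 0 \<le> t \<and> t \<le> 1 \<and> 0 \<le> r \<and> r \<le> 1 \<longrightarrow> \<bar>poly (poly Q [:t:]) r\<bar> \<le> B"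
proof (induction Q)
  case 0
  then show ?case by (intro exI[of _ 0]) simp
next
  case (pCons a Q)
  then obtain B where B: "B \<ge> 0"
    "\<And>t r. 0 \<le> t \<Longrightarrow> t \<le> 1 \<Longrightarrow> 0 \<le> r \<Longrightarrow> r \<le> 1 \<Longrightarrow> \<bar>poly (poly Q [:t:]) r\<bar> \<le> B" by blast
  obtain A where A: "A \<ge> 0" "\<forall>x. 0 \<le> x \<and> x \<le> 1 \<longrightarrow> \<bar>poly a x\<bar> \<le> A"
    using abs_poly_le_on_unit by blast
  have "\<bar>poly a r + t * poly (poly Q [:t:]) r\<bar> \<le> A + B"
    if "0 \<le> t" "t \<le> 1" "0 \<le> r" "r \<le> 1" for t r
  proof -
    have "t * \<bar>poly (poly Q [:t:]) r\<bar> \<le> 1 * B" using that B by (intro mult_mono) auto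
    moreover have "\<bar>t * poly (poly Q [:t:]) r\<bar> = t * \<bar>poly (poly Q [:t:]) r\<bar>" using that by (simp add: abs_mult)
    moreover have "\<bar>poly a r\<bar> \<le> A" using A that by blast
    ultimately show ?thesis by linarith
  qed
  then show ?case using A(1) B(1) by (intro exI[of _ "A + B"]) simp
qed

lemma abs_poly_ge_power_near_0:
  fixes p :: "real poly"
  assumes "p \<noteq> 0"
  shows "\<exists>c>0. \<exists>\<delta>>0. \<exists>m. \<forall>x. 0 \<le> x \<and> x \<le> \<delta> \<longrightarrow> c * x ^ m \<le> \<bar>poly p x\<bar>"
  using assms
proof (induction p)
  case 0
  then show ?case by simp
next
  case (pCons a p)
  show ?case
  proof (cases "a = 0")
    case True
    then obtain c \<delta> m where c: "c > 0" "\<delta> > 0" "\<And>x. 0 \<le> x \<Longrightarrow> x \<le> \<delta> \<Longrightarrow> c * x ^ m \<le> \<bar>poly p x\<bar>"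
      using pCons by blast
    have "c * x ^ Suc m \<le> \<bar>poly (pCons a p) x\<bar>" if "0 \<le> x" "x \<le> \<delta>" for x
      using mult_left_mono[OF c(3)[OF that] that(1)] that True by (simp add: abs_mult mult_ac)
    then show ?thesis using c by blast
  next
    case False
    obtain B where B: "B \<ge> 0" "\<forall>x. 0 \<le> x \<and> x \<le> 1 \<longrightarrow> \<bar>poly p x\<bar> \<le> B"
      using abs_poly_le_on_unit by blast
    define \<delta> where "\<delta> = min 1 (\<bar>a\<bar> / (2 * (B + 1)))"
    have "\<delta> > 0" using False B by (simp add: \<delta>_def)
    moreover have "\<bar>a\<bar> / 2 * x ^ 0 \<le> \<bar>poly (pCons a p) x\<bar>" if x: "0 \<le> x" "x \<le> \<delta>" for x
    proof -
      have x1: "x \<le> 1" "x \<le> \<bar>a\<bar> / (2 * (B + 1))" using x by (simp_all add: \<delta>_def)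
      have "\<bar>x * poly p x\<bar> = x * \<bar>poly p x\<bar>" using x by (simp add: abs_mult)
      also have "\<dots> \<le> (\<bar>a\<bar> / (2 * (B + 1))) * (B + 1)"
        using B x x1 by (intro mult_mono) (force simp: add_increasing2)+
      also have "\<dots> = \<bar>a\<bar> / 2" using B by (simp add: field_simps)
      finally have "\<bar>x * poly p x\<bar> \<le> \<bar>a\<bar> / 2" .
      then have "\<bar>a\<bar> / 2 \<le> \<bar>a + x * poly p x\<bar>" by linarith
      then show ?thesis by simp
    qed
    ultimately show ?thesis using False by (metis half_gt_zero zero_less_abs_iff)
  qed
qed

text \<open>
  After division by the highest possible power of \<open>t\<close> the equation reads \<open>a(r) = - t Q(t, r)\<close> with \<open>a \<noteq> 0\<close>.
  The right-hand side is at most a multiple of \<open>t\<close>, and the left-hand side is at least a multiple of a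
  power of \<open>r\<close>. The exponent is kept positive in order to have a root taken of it.
\<close>

lemma curve_bound_near_0:
  fixes Q :: "real poly poly"
  assumes "Q \<noteq> 0"
  shows "\<exists>\<delta>>0. \<exists>C>0. \<exists>m. \<forall>t r. 0 < t \<and> t \<le> 1 \<and> 0 \<le> r \<and> r \<le> \<delta> \<and>
           poly (poly Q [:t:]) r = 0 \<longrightarrow> r ^ Suc m \<le> C * t"
  using assms
proof (induction Q)
  case 0
  then show ?case by simp
next
  case (pCons a Q)
  show ?case
  proof (cases "a = 0")
    case True
    then have "Q \<noteq> 0" using pCons by auto
    then obtain \<delta> C m where *: "\<delta> > 0" "C > 0" "\<And>t r. 0 < t \<Longrightarrow> t \<le> 1 \<Longrightarrow> 0 \<le> r \<Longrightarrow> r \<le> \<delta> \<Longrightarrow>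
           poly (poly Q [:t:]) r = 0 \<Longrightarrow> r ^ Suc m \<le> C * t" using pCons.IH by blast
    show ?thesis
      by (intro exI[of _ \<delta>] conjI exI[of _ C] exI[of _ m] allI impI) (use * True in auto)
  next
    case False
    obtain c \<delta> m where c: "c > 0" "\<delta> > 0" "\<And>x. 0 \<le> x \<Longrightarrow> x \<le> \<delta> \<Longrightarrow> c * x ^ m \<le> \<bar>poly a x\<bar>"
      using abs_poly_ge_power_near_0[OF False] by blast
    obtain B where B: "B \<ge> 0" "\<And>t r. 0 \<le> t \<Longrightarrow> t \<le> 1 \<Longrightarrow> 0 \<le> r \<Longrightarrow> r \<le> 1 \<Longrightarrow> \<bar>poly (poly Q [:t:]) r\<bar> \<le> B"
      using abs_bivariate_poly_le_on_unit[of Q] by blast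
    have "r ^ Suc m \<le> ((B + 1) / c) * t"
      if tr: "0 < t" "t \<le> 1" "0 \<le> r" "r \<le> min 1 \<delta>" and zero: "poly (poly (pCons a Q) [:t:]) r = 0" for t r
    proof -
      have "poly a r = - (t * poly (poly Q [:t:]) r)" using zero by simp
      then have "\<bar>poly a r\<bar> = t * \<bar>poly (poly Q [:t:]) r\<bar>" using tr by (simp add: abs_mult)
      also have "\<dots> \<le> t * (B + 1)" using B(2)[of t r] tr by (intro mult_left_mono) auto
      finally have "c * r ^ m \<le> t * (B + 1)" using c(3)[of r] tr by simp
      then have "r ^ m \<le> ((B + 1) / c) * t" using c(1) by (simp add: field_simps)
      moreover have "r * r ^ m \<le> 1 * r ^ m" using tr by (intro mult_right_mono) auto
      ultimately show ?thesis by simp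
    qed
    moreover have "min 1 \<delta> > 0" "(B + 1) / c > 0" using c B by auto
    ultimately show ?thesis by blast
  qed
qed

lemma abs_poly_le_power_at_top:
  fixes p :: "real poly"
  shows "\<exists>B\<ge>0. \<exists>n. \<forall>x\<ge>1. \<bar>poly p x\<bar> \<le> B * x ^ n"
proof (induction p)
  case 0
  then show ?case by (intro exI[of _ 0]) simp
next
  case (pCons a p)
  then obtain B n where B: "B \<ge> 0" "\<And>x. 1 \<le> x \<Longrightarrow> \<bar>poly p x\<bar> \<le> B * x ^ n" by blast
  have "\<bar>poly (pCons a p) x\<bar> \<le> (\<bar>a\<bar> + B) * x ^ Suc n" if x: "1 \<le> x" for x
  proof -
    have "\<bar>x * poly p x\<bar> = x * \<bar>poly p x\<bar>" using x by (simp add: abs_mult)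
    also have "\<dots> \<le> x * (B * x ^ n)" using B(2)[OF x] x by (intro mult_left_mono) auto
    finally have "\<bar>x * poly p x\<bar> \<le> B * x ^ Suc n" by (simp add: mult_ac)
    moreover have "\<bar>a\<bar> * 1 \<le> \<bar>a\<bar> * x ^ Suc n"
      by (rule mult_left_mono[OF one_le_power[OF x] abs_ge_zero])
    moreover have "\<bar>poly (pCons a p) x\<bar> \<le> \<bar>a\<bar> + \<bar>x * poly p x\<bar>" by simp
    ultimately show ?thesis unfolding distrib_right by linarith
  qed
  then show ?case using B(1) by (intro exI[of _ "\<bar>a\<bar> + B"] conjI exI[of _ "Suc n"]) auto
qed

lemma root_le_coeff_quotient:
  fixes a :: "nat \<Rightarrow> real"
  assumes zero: "(\<Sum>i\<le>d. a i * r ^ i) = 0" and lead: "\<epsilon> > 0" "\<epsilon> \<le> \<bar>a d\<bar>"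
    and B: "\<And>i. i < d \<Longrightarrow> \<bar>a i\<bar> \<le> B" and "1 \<le> r"
  shows "r \<le> d * B / \<epsilon>"
proof (cases d)
  case 0
  then show ?thesis using zero lead by simp
next
  case (Suc k)
  have "a d * r ^ d = - (\<Sum>i<d. a i * r ^ i)" using zero by (simp flip: lessThan_Suc_atMost)
  then have "\<bar>a d\<bar> * r ^ d = \<bar>\<Sum>i<d. a i * r ^ i\<bar>" using \<open>1 \<le> r\<close> by (metis abs_minus_cancel abs_mult abs_of_nonneg order_trans zero_le_one zero_le_power)
  also have "\<dots> \<le> (\<Sum>i<d. \<bar>a i * r ^ i\<bar>)" by (rule sum_abs)
  also have "\<dots> \<le> (\<Sum>i<d. B * r ^ k)"
  proof (rule sum_mono)
    fix i assume "i \<in> {..<d}"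
    then have i: "i < d" "i \<le> k" using Suc by auto
    have "\<bar>a i\<bar> * r ^ i \<le> B * r ^ k"
      using B[OF i(1)] i(2) \<open>1 \<le> r\<close> by (intro mult_mono power_increasing) auto
    then show "\<bar>a i * r ^ i\<bar> \<le> B * r ^ k" using \<open>1 \<le> r\<close> by (simp add: abs_mult)
  qed
  also have "\<dots> = (d * B) * r ^ k" by simp
  finally have "\<bar>a d\<bar> * r * r ^ k \<le> (d * B) * r ^ k" using Suc by (simp add: mult_ac)
  then have "\<bar>a d\<bar> * r \<le> d * B" using \<open>1 \<le> r\<close> by simp
  moreover have "\<epsilon> * r \<le> \<bar>a d\<bar> * r" using lead \<open>1 \<le> r\<close> by (intro mult_right_mono) auto
  ultimately show ?thesis using lead by (simp add: field_simps)
qed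

text \<open>
  The leading coefficient of \<open>P\<close>, a nonzero polynomial in \<open>t\<close>, stays away from \<open>0\<close> for large \<open>t\<close>, while the
  other coefficients grow at most like a power. Cauchy's bound for the roots of a polynomial in \<open>r\<close> then
  gives the estimate.
\<close>

lemma curve_bound_at_top:
  fixes P :: "real poly poly"
  assumes "P \<noteq> 0"
  shows "\<exists>T\<ge>1. \<exists>C>0. \<exists>n. \<forall>t\<ge>T. \<forall>r\<ge>0. poly (poly P [:r:]) t = 0 \<longrightarrow> r \<le> C * t ^ Suc n"
proof -
  define d where "d = degree P"
  have expand: "poly (poly P [:r:]) t = (\<Sum>i\<le>d. poly (coeff P i) t * r ^ i)" for t r
    by (simp add: poly_altdef[of P] d_def poly_sum poly_power)
  let ?c = "coeff P d"
  have "?c \<noteq> 0" using assms by (simp add: d_def)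
  then have lc: "lead_coeff ?c \<noteq> 0" by simp
  have "\<exists>T0. \<forall>t\<ge>T0. \<bar>lead_coeff ?c\<bar> \<le> \<bar>poly ?c t\<bar>"
  proof (cases "lead_coeff ?c > 0")
    case True
    then show ?thesis using poly_pinfty_gt_lc[of ?c] by force
  next
    case False
    then have "lead_coeff ?c < 0" using lc by linarith
    then have "lead_coeff (- ?c) > 0" by simp
    then show ?thesis using poly_pinfty_gt_lc[of "- ?c"] by force
  qed
  then obtain T0 where T0: "\<And>t. T0 \<le> t \<Longrightarrow> \<bar>lead_coeff ?c\<bar> \<le> \<bar>poly ?c t\<bar>" by blast
  have "\<exists>B n. \<forall>i<d. \<forall>t\<ge>1. \<bar>poly (coeff P i) t\<bar> \<le> B * t ^ n \<and> B \<ge> 0" for d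
  proof (induction d)
    case 0
    show ?case by simp
  next
    case (Suc d)
    then obtain B n where B: "\<And>i t. i < d \<Longrightarrow> 1 \<le> t \<Longrightarrow> \<bar>poly (coeff P i) t\<bar> \<le> B * t ^ n \<and> B \<ge> 0" by blast
    obtain A m where A: "A \<ge> 0" "\<And>t. 1 \<le> t \<Longrightarrow> \<bar>poly (coeff P d) t\<bar> \<le> A * t ^ m"
      using abs_poly_le_power_at_top[of "coeff P d"] by blast
    have "\<bar>poly (coeff P i) t\<bar> \<le> max A B * t ^ max m n \<and> max A B \<ge> 0" if "i < Suc d" "1 \<le> t" for i t
    proof (cases "i = d")
      case True
      have "A * t ^ m \<le> max A B * t ^ max m n"
        using A(1) that by (intro mult_mono power_increasing) auto
      then show ?thesis using A(2)[OF that(2)] A(1) True by auto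
    next
      case False
      then have i: "i < d" using that by simp
      have "B * t ^ n \<le> max A B * t ^ max m n"
        using B[OF i that(2)] that by (intro mult_mono power_increasing) auto
      then show ?thesis using B[OF i that(2)] by auto
    qed
    then show ?case by blast
  qed
  then obtain B n where B: "\<And>i t. i < d \<Longrightarrow> 1 \<le> t \<Longrightarrow> \<bar>poly (coeff P i) t\<bar> \<le> B * t ^ n \<and> B \<ge> 0"
    by blast
  define q where "q = d * B / \<bar>lead_coeff ?c\<bar>"
  define C where "C = 1 + \<bar>q\<bar>"
  have C_ge1: "q \<le> C" unfolding C_def by linarith
  have C_ge2: "1 \<le> C" unfolding C_def by linarith
  have "r \<le> C * t ^ Suc n" if t: "max 1 T0 \<le> t" and r: "0 \<le> r" "poly (poly P [:r:]) t = 0" for t r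
  proof (cases "1 \<le> r")
    case True
    have "r \<le> d * (B * t ^ n) / \<bar>lead_coeff ?c\<bar>"
      by (rule root_le_coeff_quotient[where a = "\<lambda>i. poly (coeff P i) t"])
        (use r t T0 B lc True expand in auto)
    also have "\<dots> = q * t ^ n" by (simp add: q_def)
    also have "\<dots> \<le> C * t ^ Suc n"
      by (intro mult_mono power_increasing) (use t C_ge1 C_ge2 in simp_all)
    finally show ?thesis .
  next
    case False
    have "1 * 1 \<le> C * t ^ Suc n" by (intro mult_mono one_le_power) (use t C_ge1 C_ge2 in simp_all)
    then show ?thesis using False by simp
  qed
  moreover have "C > 0" using C_ge2 by linarith
  ultimately show ?thesis by (intro exI[of _ "max 1 T0"] exI[of _ C]) auto
qed

text \<open>
  The hypothesis \<open>lim\<close> brings \<open>\<phi>\<close> into the range of the estimate near the origin, which selects the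
  branch of the curve through it; other branches may exist. Between the two ranges of the
  estimates monotonicity bounds \<open>\<phi>\<close> by a constant, which the power \<open>t powr \<alpha>\<close> dominates.
\<close>

lemma power_bound_of_function_on_curve:
  fixes \<phi> :: "real \<Rightarrow> real" and P Q :: "real poly poly"
  assumes nonneg: "\<And>t. 0 < t \<Longrightarrow> 0 \<le> \<phi> t" and mono: "\<And>s t. 0 < s \<Longrightarrow> s \<le> t \<Longrightarrow> \<phi> s \<le> \<phi> t"
    and lim: "\<And>\<epsilon>. 0 < \<epsilon> \<Longrightarrow> \<exists>\<delta>>0. \<phi> \<delta> \<le> \<epsilon>"
    and "P \<noteq> 0" "Q \<noteq> 0"
    and curve: "\<And>t. 0 < t \<Longrightarrow> 0 < \<phi> t \<Longrightarrow> poly (poly P [:\<phi> t:]) t = 0 \<and> poly (poly Q [:t:]) (\<phi> t) = 0"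
  shows "\<exists>C \<alpha> \<beta>. 0 < C \<and> 0 < \<alpha> \<and> 0 < \<beta> \<and> (\<forall>t>0. \<phi> t \<le> C * (t powr \<alpha> + t powr \<beta>))"
proof -
  obtain \<delta> A m where \<delta>: "\<delta> > 0" "A > 0" "\<And>t r. 0 < t \<Longrightarrow> t \<le> 1 \<Longrightarrow> 0 \<le> r \<Longrightarrow> r \<le> \<delta> \<Longrightarrow>
      poly (poly Q [:t:]) r = 0 \<Longrightarrow> r ^ Suc m \<le> A * t"
    using curve_bound_near_0[OF \<open>Q \<noteq> 0\<close>] by blast
  obtain T B n where T: "1 \<le> T" "B > 0" "\<And>t r. T \<le> t \<Longrightarrow> 0 \<le> r \<Longrightarrow> poly (poly P [:r:]) t = 0 \<Longrightarrow> r \<le> B * t ^ Suc n"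
    using curve_bound_at_top[OF \<open>P \<noteq> 0\<close>] by blast
  obtain s where s: "0 < s" "\<phi> s \<le> \<delta>" using lim \<delta>(1) by blast
  define t0 where "t0 = min 1 s"
  have t0: "0 < t0" "t0 \<le> 1" "t0 \<le> T" using s T by (auto simp: t0_def)
  define \<alpha> where "\<alpha> = 1 / real (Suc m)"
  define \<beta> where "\<beta> = real (Suc n)"
  have ab: "0 < \<alpha>" "0 < \<beta>" by (simp_all add: \<alpha>_def \<beta>_def)
  define K where "K = \<phi> T / t0 powr \<alpha>"
  define C where "C = A powr \<alpha> + B + K"
  have pos: "0 \<le> A powr \<alpha>" "0 < B" "0 \<le> K" using T nonneg[of T] t0 by (auto simp: K_def)
  have "\<phi> t \<le> C * (t powr \<alpha> + t powr \<beta>)" if t: "0 < t" for t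
  proof -
    consider "t \<le> t0" | "t0 \<le> t" "t \<le> T" | "T \<le> t" by linarith
    then have "\<phi> t \<le> A powr \<alpha> * t powr \<alpha> \<or> \<phi> t \<le> K * t powr \<alpha> \<or> \<phi> t \<le> B * t powr \<beta>"
    proof cases
      case 1
      show ?thesis
      proof (cases "\<phi> t = 0")
        case True
        then show ?thesis by simp
      next
        case False
        then have \<phi>: "0 < \<phi> t" using nonneg[OF t] by simp
        have "\<phi> t \<le> \<delta>" using mono[OF t, of s] 1 s by (simp add: t0_def)
        then have "\<phi> t ^ Suc m \<le> A * t" using \<delta>(3)[of t "\<phi> t"] curve[OF t \<phi>] \<phi> t 1 t0 by simp
        then have "(\<phi> t ^ Suc m) powr \<alpha> \<le> (A * t) powr \<alpha>" using \<phi> ab by (intro powr_mono2) auto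
        moreover have "(\<phi> t ^ Suc m) powr \<alpha> = \<phi> t"
          using \<phi> by (simp add: \<alpha>_def powr_powr flip: powr_realpow del: power_Suc)
        ultimately show ?thesis using \<delta>(2) t by (simp add: powr_mult)
      qed
    next
      case 2
      have "\<phi> t \<le> \<phi> T" using mono t 2 by simp
      also have "\<dots> = K * t0 powr \<alpha>" using t0 by (simp add: K_def)
      also have "\<dots> \<le> K * t powr \<alpha>" using 2 t0 ab pos by (intro mult_left_mono powr_mono2) auto
      finally show ?thesis by simp
    next
      case 3
      have "\<phi> t \<le> B * t ^ Suc n"
      proof (cases "\<phi> t = 0")
        case True
        then show ?thesis using T t by simp
      next
        case False
        then show ?thesis using T(3)[OF 3, of "\<phi> t"] curve[OF t] nonneg[OF t] by simp
      qed
      then show ?thesis using t by (simp add: \<beta>_def powr_realpow del: power_Suc of_nat_Suc)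
    qed
    moreover have "A powr \<alpha> * t powr \<alpha> \<le> C * (t powr \<alpha> + t powr \<beta>)"
      using pos by (intro mult_mono) (auto simp: C_def)
    moreover have "K * t powr \<alpha> \<le> C * (t powr \<alpha> + t powr \<beta>)"
      using pos by (intro mult_mono) (auto simp: C_def)
    moreover have "B * t powr \<beta> \<le> C * (t powr \<alpha> + t powr \<beta>)"
      using pos by (intro mult_mono) (auto simp: C_def)
    ultimately show ?thesis by linarith
  qed
  moreover have "C > 0" using pos unfolding C_def by linarith
  ultimately show ?thesis using ab by blast
qed

section \<open>Quantification over points of a semialgebraic set\<close>

lemma real_polynomial_function_of_variables:
  fixes g :: "(real ^ 'n) \<times> real \<Rightarrow> real" and \<tau> :: "'n \<Rightarrow> 'v"
  assumes "real_polynomial_function g"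
  shows "(\<lambda>e. g (\<chi> i. e (\<tau> i), e s)) \<in> polynomial_maps"
  using assms
proof induction
  case (linear g)
  then interpret g: bounded_linear g .
  have "g (\<chi> i. e (\<tau> i), e s) = (\<Sum>i\<in>UNIV. e (\<tau> i) * g (axis i 1, 0)) + e s * g (0, 1)" for e
  proof -
    have "(\<chi> i. e (\<tau> i)) = (\<Sum>i\<in>UNIV. e (\<tau> i) *\<^sub>R axis i (1::real))"
      by (subst basis_expansion[symmetric]) (simp add: scalar_mult_eq_scaleR)
    then have "(\<chi> i. e (\<tau> i), e s) = (\<Sum>i\<in>UNIV. e (\<tau> i) *\<^sub>R (axis i (1::real), 0)) + e s *\<^sub>R (0, 1)"
      by (simp add: prod_eq_iff fst_sum snd_sum)
    then show ?thesis by (simp only: g.add g.sum g.scaleR real_scaleR_def)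
  qed
  then show ?case
    by (simp) (intro polynomial_maps.add polynomial_maps_sum polynomial_maps.mult polynomial_maps.var
      polynomial_maps.const finite)
qed (auto intro: polynomial_maps.intros)

lemma sign_determined_semialgebraic:
  fixes A :: "((real ^ 'n) \<times> real) set" and \<tau> :: "'n \<Rightarrow> 'v"
  assumes "semialgebraic A"
  shows "sign_determined {e. (\<chi> i. e (\<tau> i), e s) \<in> A}"
proof -
  let ?L = "\<lambda>e. (\<chi> i. e (\<tau> i), e s)"
  have basic: "sign_determined {e. ?L e \<in> B}" if B: "basic_semialgebraic B" for B
  proof -
    obtain P Q where PQ: "finite P" "finite Q" "\<And>g. g \<in> P \<union> Q \<Longrightarrow> real_polynomial_function g"
      and B_eq: "B = {x. (\<forall>g\<in>P. g x = 0) \<and> (\<forall>g\<in>Q. g x > 0)}"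
      using B unfolding basic_semialgebraic_def by blast
    have "{e. ?L e \<in> B} = (\<Inter>g\<in>P. {e. g (?L e) = 0}) \<inter> (\<Inter>g\<in>Q. {e. g (?L e) > 0})"
      by (auto simp: B_eq)
    moreover have "sign_determined \<dots>"
      by (intro sign_determined_Int sign_determined_INT sign_determined_zero sign_determined_pos
          real_polynomial_function_of_variables PQ) auto
    ultimately show ?thesis by simp
  qed
  obtain F where F: "finite F" "\<And>B. B \<in> F \<Longrightarrow> basic_semialgebraic B" "A = \<Union>F"
    using assms unfolding semialgebraic_def by blast
  have "{e. ?L e \<in> A} = (\<Union>B\<in>F. {e. ?L e \<in> B})" using F(3) by auto
  moreover have "sign_determined \<dots>" by (intro sign_determined_UN basic F)
  ultimately show ?thesis by simp
qed

text \<open>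
  The graph is intersected with the half-space \<open>e s \<le> a e\<close>, and then the value of the function, held by
  the fresh variable \<open>s\<close>, is projected away.
\<close>

lemma sign_determined_semialgebraic_function_le:
  fixes f :: "real ^ 'n \<Rightarrow> real" and \<tau> :: "'n \<Rightarrow> 'v"
  assumes "semialgebraic_function f" "a \<in> polynomial_maps"
    and fresh: "\<And>i. \<tau> i \<noteq> s" "\<And>e y. a (e(s := y)) = a e"
  shows "sign_determined {e. f (\<chi> i. e (\<tau> i)) \<le> a e}"
proof -
  let ?G = "{e. (\<chi> i. e (\<tau> i), e s) \<in> range (\<lambda>x. (x, f x))} \<inter> {e. a e - e s \<ge> 0}"
  have "sign_determined ?G"
    using assms(1,2) unfolding semialgebraic_function_def
    by (intro sign_determined_Int sign_determined_semialgebraic sign_determined_nonneg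
        polynomial_maps_diff polynomial_maps.var)
  then have "sign_determined {e. \<exists>y. e(s := y) \<in> ?G}" by (rule sign_determined_ex_variable)
  moreover have "e(s := y) \<in> ?G \<longleftrightarrow> y = f (\<chi> i. e (\<tau> i)) \<and> y \<le> a e" for e y
    using fresh by auto
  then have "{e. \<exists>y. e(s := y) \<in> ?G} = {e. f (\<chi> i. e (\<tau> i)) \<le> a e}" by simp
  ultimately show ?thesis by simp
qed

text \<open>
  The variables of the formula that compares distances: the coordinates of a point and of a competing
  point in the zero sublevel set, the level \<open>t\<close>, the radius \<open>r\<close>, and an auxiliary function value.
\<close>

datatype 'n var = Point 'n | Zero_Point 'n | Level | Radius | Value

lemma sign_determined_distance_condition:
  fixes f :: "real ^ 'n \<Rightarrow> real"
  assumes f: "semialgebraic_function f"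
  shows "sign_determined {e :: 'n var \<Rightarrow> real. \<exists>x. f x \<le> e Level \<and>
           (\<forall>y. f y \<le> 0 \<longrightarrow> (e Radius)\<^sup>2 \<le> (norm (x - y))\<^sup>2)}"
proof -
  let ?x = "\<lambda>e :: 'n var \<Rightarrow> real. \<chi> i. e (Point i)" and ?y = "\<lambda>e :: 'n var \<Rightarrow> real. \<chi> i. e (Zero_Point i)"
  let ?near = "{e. f (?y e) \<le> 0} \<inter> - {e. (norm (?x e - ?y e))\<^sup>2 - (e Radius)\<^sup>2 \<ge> 0}"
  let ?far = "- {e. \<exists>u. override_on e u (range Zero_Point) \<in> ?near}"
  let ?sub = "{e. f (?x e) \<le> e Level}"
  have norm: "(norm (?x e - ?y e))\<^sup>2 = (\<Sum>i\<in>UNIV. (e (Point i) - e (Zero_Point i)) * (e (Point i) - e (Zero_Point i)))" for e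
    by (simp add: power2_norm_eq_inner inner_vec_def)
  have "(\<lambda>e. (norm (?x e - ?y e))\<^sup>2 - (e Radius)\<^sup>2) \<in> polynomial_maps"
    unfolding norm unfolding power2_eq_square
    by (intro polynomial_maps_diff polynomial_maps_sum polynomial_maps.mult polynomial_maps.var finite)
  moreover have "sign_determined {e :: 'n var \<Rightarrow> real. f (?y e) \<le> 0}"
    by (rule sign_determined_semialgebraic_function_le[OF f, where s = Value]) (auto intro: polynomial_maps.const)
  ultimately have "sign_determined ?near"
    by (intro sign_determined_Int sign_determined_Compl sign_determined_nonneg)
  then have far: "sign_determined ?far"
    by (intro sign_determined_Compl sign_determined_ex_variables) simp_all
  have sub: "sign_determined ?sub"
    by (rule sign_determined_semialgebraic_function_le[OF f, where s = Value]) (auto intro: polynomial_maps.var)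
  have D: "sign_determined {e. \<exists>u. override_on e u (range Point) \<in> ?sub \<inter> ?far}"
    by (intro sign_determined_ex_variables sign_determined_Int sub far) simp
  have far_iff: "e \<in> ?far \<longleftrightarrow> (\<forall>y. f y \<le> 0 \<longrightarrow> (e Radius)\<^sup>2 \<le> (norm (?x e - y))\<^sup>2)" for e
  proof -
    have near: "override_on e u (range Zero_Point) \<in> ?near \<longleftrightarrow>
        f (\<chi> i. u (Zero_Point i)) \<le> 0 \<and> (norm (?x e - (\<chi> i. u (Zero_Point i))))\<^sup>2 < (e Radius)\<^sup>2" for u
      by (simp add: override_on_def image_iff not_le)
    have "\<exists>u :: 'n var \<Rightarrow> real. (\<chi> i. u (Zero_Point i)) = y" for y :: "real ^ 'n"
      by (rule exI[of _ "\<lambda>v. case v of Zero_Point i \<Rightarrow> y $ i | _ \<Rightarrow> 0"]) simp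
    then have "(\<exists>u. override_on e u (range Zero_Point) \<in> ?near) \<longleftrightarrow>
        (\<exists>y. f y \<le> 0 \<and> (norm (?x e - y))\<^sup>2 < (e Radius)\<^sup>2)"
      unfolding near by metis
    then show ?thesis by (simp del: Int_iff) (meson not_le)
  qed
  have "(\<exists>u. override_on e u (range Point) \<in> ?sub \<inter> ?far) \<longleftrightarrow>
      (\<exists>x. f x \<le> e Level \<and> (\<forall>y. f y \<le> 0 \<longrightarrow> (e Radius)\<^sup>2 \<le> (norm (x - y))\<^sup>2))" for e :: "'n var \<Rightarrow> real"
  proof -
    have step: "override_on e u (range Point) \<in> ?sub \<inter> ?far \<longleftrightarrow>
        f (\<chi> i. u (Point i)) \<le> e Level \<and>
        (\<forall>y. f y \<le> 0 \<longrightarrow> (e Radius)\<^sup>2 \<le> (norm ((\<chi> i. u (Point i)) - y))\<^sup>2)" for u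
    proof -
      let ?e = "override_on e u (range Point)"
      have "?e \<in> ?sub \<inter> ?far \<longleftrightarrow> ?e \<in> ?sub \<and> ?e \<in> ?far" by (rule Int_iff)
      also have "\<dots> \<longleftrightarrow> f (?x ?e) \<le> ?e Level \<and>
          (\<forall>y. f y \<le> 0 \<longrightarrow> (?e Radius)\<^sup>2 \<le> (norm (?x ?e - y))\<^sup>2)"
        unfolding far_iff by simp
      finally show ?thesis by (simp add: override_on_def image_iff)
    qed
    have "\<exists>u :: 'n var \<Rightarrow> real. (\<chi> i. u (Point i)) = x" for x :: "real ^ 'n"
      by (rule exI[of _ "\<lambda>v. case v of Point i \<Rightarrow> x $ i | _ \<Rightarrow> 0"]) simp
    then show ?thesis unfolding step by metis
  qed
  then show ?thesis using D by simp
qed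

text \<open>
  The two conditions on \<open>r\<close> say that \<open>r\<close> is the supremum of the distances over the sublevel set. The
  fibre over \<open>t\<close> of the set in \<open>sign_determined_distance_condition\<close> then agrees, among positive numbers,
  with an interval that ends in \<open>r\<close>, whether or not the supremum is attained; so \<open>r\<close> is a frontier point.
  Positivity of \<open>r\<close> is essential because the distance is compared by squares.
\<close>

lemma max_infdist_on_curve:
  fixes f :: "real ^ 'n \<Rightarrow> real"
  assumes f: "semialgebraic_function f" and S: "S = {x. f x \<le> 0}" "S \<noteq> {}"
  shows "\<exists>P Q :: real poly poly. P \<noteq> 0 \<and> Q \<noteq> 0 \<and>
    (\<forall>t r. 0 < r \<longrightarrow> (\<forall>x. f x \<le> t \<longrightarrow> infdist x S \<le> r) \<longrightarrow>
        (\<forall>s<r. \<exists>x. f x \<le> t \<and> s < infdist x S) \<longrightarrow>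
        poly (poly P [:r:]) t = 0 \<and> poly (poly Q [:t:]) r = 0)"
proof -
  let ?D = "{e :: 'n var \<Rightarrow> real. \<exists>x. f x \<le> e Level \<and>
           (\<forall>y. f y \<le> 0 \<longrightarrow> (e Radius)\<^sup>2 \<le> (norm (x - y))\<^sup>2)}"
  let ?E = "\<lambda>t r u. if u = Level then t else if u = Radius then r else (0 :: real)"
  define fibre where "fibre t = {r. ?E t r \<in> ?D}" for t
  have "\<exists>P Q :: real poly poly. P \<noteq> 0 \<and> Q \<noteq> 0 \<and>
      (\<forall>t. \<forall>r \<in> frontier (fibre t). poly (poly P [:r:]) t = 0 \<and> poly (poly Q [:t:]) r = 0)"
    unfolding fibre_def
    by (rule frontier_of_fibre_on_curve[OF sign_determined_distance_condition[OF f]]) simp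
  then obtain P Q :: "real poly poly" where PQ: "P \<noteq> 0" "Q \<noteq> 0" and
    curve: "\<forall>t. \<forall>r \<in> frontier (fibre t). poly (poly P [:r:]) t = 0 \<and> poly (poly Q [:t:]) r = 0"
    by (elim exE conjE)
  have fibre_iff: "r \<in> fibre t \<longleftrightarrow> (\<exists>x. f x \<le> t \<and> r \<le> infdist x S)" if "0 < r" for t r
  proof -
    have "(\<forall>y. f y \<le> 0 \<longrightarrow> r\<^sup>2 \<le> (norm (x - y))\<^sup>2) \<longleftrightarrow> r \<le> infdist x S" for x
    proof -
      have "r\<^sup>2 \<le> (norm (x - y))\<^sup>2 \<longleftrightarrow> r \<le> dist x y" for y
        using that by (simp add: dist_norm flip: abs_le_square_iff)
      then have "(\<forall>y. f y \<le> 0 \<longrightarrow> r\<^sup>2 \<le> (norm (x - y))\<^sup>2) \<longleftrightarrow> (\<forall>y\<in>S. r \<le> dist x y)"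
        by (simp add: S)
      also have "\<dots> \<longleftrightarrow> r \<le> infdist x S"
        using S(2) infdist_le[of _ S x] by (auto simp: infdist_notempty intro: cINF_greatest order_trans)
      finally show ?thesis .
    qed
    then show ?thesis by (simp add: fibre_def)
  qed
  have frontier: "r \<in> frontier (fibre t)"
    if r: "0 < r" and upper: "\<forall>x. f x \<le> t \<longrightarrow> infdist x S \<le> r" and lower: "\<forall>s<r. \<exists>x. f x \<le> t \<and> s < infdist x S" for t r
  proof -
    have inside: "s \<in> fibre t" if "0 < s" "s < r" for s
      unfolding fibre_iff[OF that(1)] using lower that(2) by (meson less_imp_le)
    have outside: "s \<notin> fibre t" if "r < s" for s
    proof
      assume "s \<in> fibre t"
      then obtain x where "f x \<le> t" "s \<le> infdist x S" using fibre_iff[of s t] r \<open>r < s\<close> by auto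
      then show False using upper \<open>r < s\<close> by force
    qed
    have "r \<in> closure (fibre t)"
    proof (subst closure_approachable, intro allI impI)
      fix \<epsilon> :: real assume "0 < \<epsilon>"
      define s where "s = max (r / 2) (r - \<epsilon> / 2)"
      have "0 < s" "s < r" "dist s r < \<epsilon>" using r \<open>0 < \<epsilon>\<close> by (auto simp: s_def dist_real_def)
      then show "\<exists>y\<in>fibre t. dist y r < \<epsilon>" using inside[of s] by blast
    qed
    moreover have "r \<notin> interior (fibre t)"
    proof
      assume "r \<in> interior (fibre t)"
      then obtain \<epsilon> where \<epsilon>: "0 < \<epsilon>" "ball r \<epsilon> \<subseteq> fibre t" by (auto simp: mem_interior)
      have "r + \<epsilon> / 2 \<in> ball r \<epsilon>" using \<epsilon>(1) by (simp add: dist_real_def)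
      then show False using \<epsilon> outside[of "r + \<epsilon> / 2"] by auto
    qed
    ultimately show ?thesis by (simp add: frontier_def)
  qed
  show ?thesis
  proof (rule exI[of _ P], rule exI[of _ Q], intro conjI PQ allI impI)
    fix t r :: real
    assume "0 < r" "\<forall>x. f x \<le> t \<longrightarrow> infdist x S \<le> r" "\<forall>s<r. \<exists>x. f x \<le> t \<and> s < infdist x S"
    then have "r \<in> frontier (fibre t)" by (rule frontier)
    then show "poly (poly P [:r:]) t = 0" "poly (poly Q [:t:]) r = 0" using curve by blast+
  qed
qed

section \<open>The error bound\<close>

lemma infdist_le_norm_add:
  assumes "a \<in> S"
  shows "infdist x S \<le> norm x + norm a"
  using infdist_le[OF assms, of x] norm_triangle_ineq4[of x a] by (simp add: dist_norm)

text \<open>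
  Points of one sublevel set whose distances tend to infinity themselves tend to infinity, since
  \<open>S\<close> contains some fixed point. The sequence condition then contradicts the bound on \<open>f\<close>.
\<close>

lemma infdist_bounded_on_sublevel:
  fixes f :: "'a::euclidean_space \<Rightarrow> real"
  assumes S: "S = {x. f x \<le> 0}" "S \<noteq> {}"
    and i2: "\<And>x :: nat \<Rightarrow> 'a. (\<And>k. x k \<notin> S) \<Longrightarrow> filterlim (\<lambda>k. norm (x k)) at_top sequentially \<Longrightarrow>
       filterlim (\<lambda>k. infdist (x k) S) at_top sequentially \<Longrightarrow> filterlim (\<lambda>k. f (x k)) at_top sequentially"
  shows "\<exists>M. \<forall>x. f x \<le> t \<longrightarrow> infdist x S \<le> M"
proof (rule ccontr)
  assume "\<not> ?thesis"
  then have "\<forall>k::nat. \<exists>x. f x \<le> t \<and> real k < infdist x S" by (meson not_le)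
  then obtain x where x: "\<And>k. f (x k) \<le> t" "\<And>k. real k < infdist (x k) S" by metis
  obtain a where a: "a \<in> S" using S(2) by blast
  have "x k \<notin> S" for k using x(2)[of k] by auto
  moreover have inf: "filterlim (\<lambda>k. infdist (x k) S) at_top sequentially"
    by (rule filterlim_at_top_mono[OF filterlim_real_sequentially])
      (intro always_eventually allI less_imp_le x(2))
  moreover have "filterlim (\<lambda>k. - norm a + infdist (x k) S) at_top sequentially"
    by (rule filterlim_tendsto_add_at_top[OF tendsto_const inf])
  then have "filterlim (\<lambda>k. norm (x k)) at_top sequentially"
  proof (rule filterlim_at_top_mono, intro always_eventually allI)
    show "- norm a + infdist (x k) S \<le> norm (x k)" for k
      using infdist_le_norm_add[OF a, of "x k"] by simp
  qed
  ultimately have "filterlim (\<lambda>k. f (x k)) at_top sequentially" by (intro i2)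
  then have "\<forall>\<^sub>F k in sequentially. t + 1 \<le> f (x k)" by (simp add: filterlim_at_top)
  from eventually_happens'[OF sequentially_bot this] obtain k where "t + 1 \<le> f (x k)" by (elim exE)
  then show False using x(1)[of k] by simp
qed

text \<open>
  On the compact part of a ball where the distance is at least \<open>\<epsilon>\<close>, the function \<open>f\<close> has a positive
  minimum. Hence points with small \<open>f\<close> but large distance leave every ball, and the sequence condition
  applies to them.
\<close>

lemma infdist_small_on_small_sublevel:
  fixes f :: "'a::euclidean_space \<Rightarrow> real"
  assumes cont: "continuous_on UNIV f" and S: "S = {x. f x \<le> 0}"
    and i1: "\<And>x :: nat \<Rightarrow> 'a. (\<And>k. x k \<notin> S) \<Longrightarrow> filterlim (\<lambda>k. norm (x k)) at_top sequentially \<Longrightarrow>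
       (\<lambda>k. f (x k)) \<longlonglongrightarrow> 0 \<Longrightarrow> (\<lambda>k. infdist (x k) S) \<longlonglongrightarrow> 0"
    and "0 < \<epsilon>"
  shows "\<exists>\<delta>>0. \<forall>x. f x \<le> \<delta> \<longrightarrow> infdist x S \<le> \<epsilon>"
proof (rule ccontr)
  assume no: "\<not> ?thesis"
  have bad: "\<exists>x. f x \<le> \<delta> \<and> \<epsilon> < infdist x S" if "0 < \<delta>" for \<delta>
    using no that by (meson not_le)
  have far: "\<exists>x. f x \<le> 1 / Suc k \<and> \<epsilon> < infdist x S \<and> real k \<le> norm x" for k
  proof -
    let ?K = "cball 0 (real k) \<inter> {x. \<epsilon> \<le> infdist x S}"
    have "closed {x. \<epsilon> \<le> infdist x S}"
      by (intro closed_Collect_le continuous_intros)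
    then have K: "compact ?K" by (simp add: compact_Int_closed)
    have pos: "0 < f x" if "x \<in> ?K" for x
    proof (rule ccontr)
      assume "\<not> 0 < f x"
      then have "x \<in> S" using S by simp
      then show False using that \<open>0 < \<epsilon>\<close> by simp
    qed
    have "\<exists>m>0. \<forall>x\<in>?K. m \<le> f x"
    proof (cases "?K = {}")
      case True
      then show ?thesis by (intro exI[of _ 1]) auto
    next
      case False
      obtain z where "z \<in> ?K" "\<And>x. x \<in> ?K \<Longrightarrow> f z \<le> f x"
        using continuous_attains_inf[OF K False continuous_on_subset[OF cont]] by blast
      then show ?thesis using pos by blast
    qed
    then obtain m where m: "0 < m" "\<And>x. x \<in> ?K \<Longrightarrow> m \<le> f x" by blast
    obtain x where x: "f x \<le> min (m / 2) (1 / Suc k)" "\<epsilon> < infdist x S"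
      using bad[of "min (m / 2) (1 / Suc k)"] m(1) by auto
    have "x \<notin> ?K" using m(2)[of x] x(1) m(1) by auto
    then have "real k \<le> norm x" using x(2) by (auto simp: dist_norm)
    then show ?thesis using x by auto
  qed
  have "\<forall>k. \<exists>x. f x \<le> 1 / Suc k \<and> \<epsilon> < infdist x S \<and> real k \<le> norm x" using far by (rule allI)
  from choice[OF this] obtain x where
    x: "\<And>k. f (x k) \<le> 1 / Suc k" "\<And>k. \<epsilon> < infdist (x k) S" "\<And>k. real k \<le> norm (x k)" by blast
  have notin: "x k \<notin> S" for k using x(2)[of k] \<open>0 < \<epsilon>\<close> by auto
  then have pos: "0 \<le> f (x k)" for k using S by (simp add: not_le less_imp_le)
  have "filterlim (\<lambda>k. norm (x k)) at_top sequentially"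
    by (rule filterlim_at_top_mono[OF filterlim_real_sequentially]) (use x(3) in auto)
  moreover have "(\<lambda>k. f (x k)) \<longlonglongrightarrow> 0"
    by (rule tendsto_sandwich[OF _ _ tendsto_const LIMSEQ_inverse_real_of_nat])
      (use pos x(1) in \<open>simp_all add: inverse_eq_divide\<close>)
  ultimately have "(\<lambda>k. infdist (x k) S) \<longlonglongrightarrow> 0" by (rule i1[OF notin])
  then have "\<forall>\<^sub>F k in sequentially. infdist (x k) S < \<epsilon>" using \<open>0 < \<epsilon>\<close> by (rule order_tendstoD(2))
  from eventually_happens'[OF sequentially_bot this] obtain k where "infdist (x k) S < \<epsilon>" by (elim exE)
  then show False using x(2)[of k] by simp
qed

lemma error_bound_if_sequence_conditions:
  fixes f :: "real ^ 'n \<Rightarrow> real"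
  assumes cont: "continuous_on UNIV f" and semialg: "semialgebraic_function f"
    and S: "S = {x. f x \<le> 0}" "S \<noteq> {}"
    and i1: "\<And>x :: nat \<Rightarrow> real ^ 'n. (\<And>k. x k \<notin> S) \<Longrightarrow> filterlim (\<lambda>k. norm (x k)) at_top sequentially \<Longrightarrow>
       (\<lambda>k. f (x k)) \<longlonglongrightarrow> 0 \<Longrightarrow> (\<lambda>k. infdist (x k) S) \<longlonglongrightarrow> 0"
    and i2: "\<And>x :: nat \<Rightarrow> real ^ 'n. (\<And>k. x k \<notin> S) \<Longrightarrow> filterlim (\<lambda>k. norm (x k)) at_top sequentially \<Longrightarrow>
       filterlim (\<lambda>k. infdist (x k) S) at_top sequentially \<Longrightarrow> filterlim (\<lambda>k. f (x k)) at_top sequentially"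
  shows "\<exists>c \<alpha> \<beta> :: real. c > 0 \<and> \<alpha> > 0 \<and> \<beta> > 0 \<and>
        (\<forall>x. c * infdist x S \<le> (max (f x) 0) powr \<alpha> + (max (f x) 0) powr \<beta>)"
proof -
  define \<phi> where "\<phi> t = (SUP x\<in>{x. f x \<le> t}. infdist x S)" for t
  have bdd: "bdd_above ((\<lambda>x. infdist x S) ` {x. f x \<le> t})" for t
  proof -
    obtain M where "\<forall>x. f x \<le> t \<longrightarrow> infdist x S \<le> M" using infdist_bounded_on_sublevel[OF S i2] by blast
    then show ?thesis by (intro bdd_aboveI2[of _ _ M]) simp
  qed
  obtain a where a: "f a \<le> 0" using S by auto
  have ne: "{x. f x \<le> t} \<noteq> {}" if "0 < t" for t
  proof -
    have "a \<in> {x. f x \<le> t}" using a that by simp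
    then show ?thesis by blast
  qed
  have upper: "infdist x S \<le> \<phi> t" if "f x \<le> t" for x t
    unfolding \<phi>_def using that by (intro cSUP_upper bdd) simp
  have least: "\<phi> t \<le> M" if "0 < t" "\<And>x. f x \<le> t \<Longrightarrow> infdist x S \<le> M" for t M
    unfolding \<phi>_def using that by (intro cSUP_least ne) auto
  have nonneg: "0 \<le> \<phi> t" if "0 < t" for t
    using upper[of a t] a that infdist_nonneg[of a S] by linarith
  have mono: "\<phi> s \<le> \<phi> t" if "0 < s" "s \<le> t" for s t
    using that by (intro least upper) auto
  have lim: "\<exists>\<delta>>0. \<phi> \<delta> \<le> \<epsilon>" if "0 < \<epsilon>" for \<epsilon>
    using infdist_small_on_small_sublevel[OF cont S(1) i1 that] least by meson
  obtain P Q :: "real poly poly" where PQ: "P \<noteq> 0" "Q \<noteq> 0" and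
    curve: "\<And>t r. 0 < r \<Longrightarrow> \<forall>x. f x \<le> t \<longrightarrow> infdist x S \<le> r \<Longrightarrow>
        \<forall>s<r. \<exists>x. f x \<le> t \<and> s < infdist x S \<Longrightarrow>
        poly (poly P [:r:]) t = 0 \<and> poly (poly Q [:t:]) r = 0"
    using max_infdist_on_curve[OF semialg S] by blast
  have approx: "\<exists>x. f x \<le> t \<and> s < infdist x S" if "0 < t" "s < \<phi> t" for s t
    using that least[of t s] by (meson leD leI)
  have "poly (poly P [:\<phi> t:]) t = 0 \<and> poly (poly Q [:t:]) (\<phi> t) = 0" if "0 < t" "0 < \<phi> t" for t
    using curve[OF that(2), of t] upper approx[OF that(1)] by blast
  from power_bound_of_function_on_curve[OF nonneg mono lim PQ this]
  obtain C \<alpha> \<beta> where C: "0 < C" "0 < \<alpha>" "0 < \<beta>" and bound: "\<And>t. 0 < t \<Longrightarrow> \<phi> t \<le> C * (t powr \<alpha> + t powr \<beta>)"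
    by blast
  have "1 / C * infdist x S \<le> (max (f x) 0) powr \<alpha> + (max (f x) 0) powr \<beta>" for x
  proof (cases "f x \<le> 0")
    case True
    then have "x \<in> S" using S by simp
    then show ?thesis by simp
  next
    case False
    then have "infdist x S \<le> C * (f x powr \<alpha> + f x powr \<beta>)"
      using upper[of x "f x"] bound[of "f x"] by simp
    then show ?thesis using False C by (simp add: field_simps)
  qed
  then show ?thesis using C by (intro exI[of _ "1 / C"] exI[of _ \<alpha>] exI[of _ \<beta>]) auto
qed

lemma sequence_conditions_if_error_bound:
  fixes f :: "'a::euclidean_space \<Rightarrow> real" and x :: "nat \<Rightarrow> 'a"
  assumes c: "c > 0" "\<alpha> > 0" "\<beta> > 0"
    and bound: "\<And>x. c * infdist x S \<le> (max (f x) 0) powr \<alpha> + (max (f x) 0) powr \<beta>"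
  shows "(\<lambda>k. f (x k)) \<longlonglongrightarrow> 0 \<Longrightarrow> (\<lambda>k. infdist (x k) S) \<longlonglongrightarrow> 0"
    and "filterlim (\<lambda>k. infdist (x k) S) at_top sequentially \<Longrightarrow>
             filterlim (\<lambda>k. f (x k)) at_top sequentially"
proof -
  let ?g = "\<lambda>s. (max s 0) powr \<alpha> + (max s 0) powr \<beta>"
  assume lim: "(\<lambda>k. f (x k)) \<longlonglongrightarrow> 0"
  have "(\<lambda>k. max (f (x k)) 0) \<longlonglongrightarrow> 0" using tendsto_max[OF lim tendsto_const[of 0]] by simp
  then have "(\<lambda>k. ?g (f (x k)) / c) \<longlonglongrightarrow> (0 powr \<alpha> + 0 powr \<beta>) / c"
    using c by (intro tendsto_intros tendsto_powr') auto
  then have g0: "(\<lambda>k. ?g (f (x k)) / c) \<longlonglongrightarrow> 0" by simp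
  show "(\<lambda>k. infdist (x k) S) \<longlonglongrightarrow> 0"
    by (rule tendsto_sandwich[OF _ _ tendsto_const g0])
      (use bound c in \<open>auto simp: field_simps infdist_nonneg\<close>)
next
  let ?g = "\<lambda>s. (max s 0) powr \<alpha> + (max s 0) powr \<beta>"
  assume inf: "filterlim (\<lambda>k. infdist (x k) S) at_top sequentially"
  show "filterlim (\<lambda>k. f (x k)) at_top sequentially"
    unfolding filterlim_at_top
  proof
    fix Z :: real
    have "\<forall>\<^sub>F k in sequentially. ?g Z / c + 1 \<le> infdist (x k) S"
      using inf by (simp add: filterlim_at_top)
    then show "\<forall>\<^sub>F k in sequentially. Z \<le> f (x k)"
    proof eventually_elim
      case (elim k)
      show ?case
      proof (rule ccontr)
        assume "\<not> Z \<le> f (x k)"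
        then have "?g (f (x k)) \<le> ?g Z" using c by (intro add_mono powr_mono2) auto
        then have "c * infdist (x k) S \<le> ?g Z" using bound[of "x k"] by linarith
        moreover have "c * (?g Z / c + 1) \<le> c * infdist (x k) S" using elim c by (intro mult_left_mono) auto
        moreover have "c * (?g Z / c) = ?g Z" using c(1) by simp
        ultimately show False using c(1) distrib_left[of c "?g Z / c" 1] by linarith
      qed
    qed
  qed
qed

theorem theorem2:
  fixes f :: "real ^ 'n \<Rightarrow> real" and S :: "(real ^ 'n) set"
  assumes cont: "continuous_on UNIV f"
    and semialg: "semialgebraic_function f"
    and S_eq: "S = {x. f x \<le> 0}"
    and S_nonempty: "S \<noteq> {}"
  shows
    "(\<forall>x :: nat \<Rightarrow> real ^ 'n.
        (\<forall>k. x k \<notin> S) \<and> filterlim (\<lambda>k. norm (x k)) at_top sequentially \<longrightarrow>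
          ((\<lambda>k. f (x k)) \<longlonglongrightarrow> 0 \<longrightarrow> (\<lambda>k. infdist (x k) S) \<longlonglongrightarrow> 0) \<and>
          (filterlim (\<lambda>k. infdist (x k) S) at_top sequentially \<longrightarrow>
             filterlim (\<lambda>k. f (x k)) at_top sequentially))
     \<longleftrightarrow>
     (\<exists>c \<alpha> \<beta> :: real. c > 0 \<and> \<alpha> > 0 \<and> \<beta> > 0 \<and>
        (\<forall>x. c * infdist x S \<le> (max (f x) 0) powr \<alpha> + (max (f x) 0) powr \<beta>))"
    (is "?sequences \<longleftrightarrow> ?bound")
proof
  assume ?sequences
  then show ?bound
    by (intro error_bound_if_sequence_conditions[OF cont semialg S_eq S_nonempty]) blast+
next
  assume ?bound
  then obtain c \<alpha> \<beta> where c: "c > 0" "\<alpha> > 0" "\<beta> > 0"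
    and bound: "\<And>x. c * infdist x S \<le> (max (f x) 0) powr \<alpha> + (max (f x) 0) powr \<beta>" by blast
  show ?sequences
    using sequence_conditions_if_error_bound[OF c bound] by blast
qed

end
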